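(* Let $n\geq 1$ be a natural number and let $C$ be a conjugation on $L^2(\mathbb{T})$ such that $CM_{z^n}=M_{z^n}C$ and $C(H^2)\subset H^2$. Then $C=M_{[\xi_1,\xi_2,\ldots,\xi_n]}J^\star$ for some $\xi_1,\ldots,\xi_n\in L^\infty(\mathbb{T})$, where $\xi_1,\,z\xi_2,\,z^2\xi_3,\ldots,\,z^{n-1}\xi_n\in H^\infty$ and $M_{[\xi_1,\xi_2,\ldots,\xi_n]}$ is a $J^\star$-symmetric unitary operator.
   Context: $\mathbb{T}$ is the unit circle with normalized Lebesgue measure; $H^2\subset L^2(\mathbb{T})$ is the Hardy space (functions whose negative Fourier coefficients vanish) and $H^\infty=H^2\cap L^\infty(\mathbb{T})$. For $\phi\in L^\infty(\mathbb{T})$, $M_\phi f=\phi f$ on $L^2(\mathbb{T})$. A conjugation on a Hilbert space $\mathcal{H}$ is an antilinear map $C:\mathcal{H}\to\mathcal{H}$ with $C^2=I$ and $\langle Cf,Cg\rangle=\langle g,f\rangle$ for all $f,g$. A bounded linear operator $T$ is $C$-symmetric if $CTC=T^*$. The conjugation $J^\star$ on $L^2(\mathbb{T})$ is $(J^\star f)(z)=\overline{f(\bar z)}$. For $f=\sum_{k\in\mathbb{Z}}a_kz^k\in L^2(\mathbb{T})$ write $f=f_1+\cdots+f_n$ with $f_i=\sum_{k\in\mathbb{Z}}a_{nk+i-1}z^{nk+i-1}$, $1\le i\le n$. For $\phi_1,\dots,\phi_n\in L^\infty(\mathbb{T})$, $M_{[\phi_1,\ldots,\phi_n]}$ is the bounded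 linear operator on $L^2(\mathbb{T})$ given by $M_{[\phi_1,\ldots,\phi_n]}f=\phi_1f_1+\cdots+\phi_nf_n$. *)

theory Defs
  imports "HOL-Analysis.Analysis"
begin

section \<open>The space of square-integrable functions on the unit circle\<close>

text \<open>
  Normalized arc length, as a Borel probability measure on the complex plane that is concentrated
  on the unit circle. The values of a function off the circle are therefore irrelevant.
\<close>

definition circle_measure :: "complex measure" where
  "circle_measure = distr (uniform_measure lborel {-pi..pi}) borel cis"

lemma sets_circle_measure [simp, measurable_cong]: "sets circle_measure = sets borel"
  by (simp add: circle_measure_def)

lemma space_circle_measure [simp]: "space circle_measure = UNIV"
  by (simp add: circle_measure_def)

lemma cis_borel_measurable [measurable]: "cis \<in> borel_measurable borel"
  by (intro borel_measurable_continuous_onI continuous_intros)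

lemma measurable_uniform_lborel [simp]:
  "measurable (uniform_measure lborel S) N = measurable borel N" for S :: "real set"
  by (rule measurable_cong_sets) simp_all

lemma finite_measure_circle: "finite_measure circle_measure"
proof -
  have "emeasure circle_measure (space circle_measure) \<noteq> \<infinity>"
    unfolding space_circle_measure by (simp add: circle_measure_def emeasure_distr)
  then show ?thesis by (rule finite_measureI)
qed

lemma AE_circle_norm: "AE z in circle_measure. norm z = 1"
  unfolding circle_measure_def by (subst AE_distr_iff) auto

lemma circle_measure_cnj: "distr circle_measure borel cnj = circle_measure"
proof -
  have cnj [measurable]: "cnj \<in> borel_measurable borel"
    by (intro borel_measurable_continuous_onI continuous_intros)
  let ?U = "uniform_measure lborel {-pi..pi}"
  have U: "distr ?U borel uminus = ?U"
  proof (rule measure_eqI)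
    fix A :: "real set" assume "A \<in> sets (distr ?U borel uminus)"
    then have A [measurable]: "A \<in> sets borel" by simp
    have "emeasure lborel ({-pi..pi} \<inter> A)
        = emeasure (distr lborel borel uminus) ({-pi..pi} \<inter> A)"
      by (simp only: lborel_distr_uminus)
    also have "\<dots> = emeasure lborel (uminus -` ({-pi..pi} \<inter> A))"
      by (subst emeasure_distr) auto
    also have "uminus -` ({-pi..pi} \<inter> A) = {-pi..pi} \<inter> (uminus -` A)"
      by auto
    finally show "emeasure (distr ?U borel uminus) A = emeasure ?U A"
      using measurable_sets_borel[of uminus borel A] by (simp add: emeasure_distr)
  qed simp
  have "distr circle_measure borel cnj = distr ?U borel (cnj \<circ> cis)"
    unfolding circle_measure_def by (subst distr_distr) auto
  also have "cnj \<circ> cis = cis \<circ> uminus"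
    by (auto simp: fun_eq_iff cis_cnj)
  also have "distr ?U borel (cis \<circ> uminus) = distr (distr ?U borel uminus) borel cis"
    by (subst distr_distr) auto
  finally show ?thesis
    by (simp add: U circle_measure_def)
qed

definition square_integrable :: "(complex \<Rightarrow> complex) \<Rightarrow> bool" where
  "square_integrable f \<longleftrightarrow>
     f \<in> borel_measurable borel \<and> integrable circle_measure (\<lambda>z. (norm (f z))\<^sup>2)"

lemma square_integrable_measurable [measurable_dest]:
  "square_integrable f \<Longrightarrow> f \<in> borel_measurable borel"
  by (simp add: square_integrable_def)

lemma measurable_circle [simp]:
  "measurable circle_measure N = measurable borel N"
  by (rule measurable_cong_sets) simp_all

lemma square_integrable_bounded:
  assumes [measurable]: "f \<in> borel_measurable borel"
    and bound: "AE z in circle_measure. norm (f z) \<le> c"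
  shows "square_integrable f"
proof -
  interpret finite_measure circle_measure by (rule finite_measure_circle)
  have "integrable circle_measure (\<lambda>z. (norm (f z))\<^sup>2)"
  proof (rule integrable_const_bound[where B = "c\<^sup>2"])
    show "AE z in circle_measure. norm ((norm (f z))\<^sup>2) \<le> c\<^sup>2"
      using bound by eventually_elim (auto intro!: power_mono)
  qed simp
  then show ?thesis by (simp add: square_integrable_def)
qed

lemma square_integrable_zero: "square_integrable (\<lambda>z. 0)"
  by (simp add: square_integrable_def)

lemma square_integrable_scale: "square_integrable f \<Longrightarrow> square_integrable (\<lambda>z. a * f z)"
  unfolding square_integrable_def norm_mult power_mult_distrib by auto

lemma square_integrable_add:
  assumes f: "square_integrable f" and g: "square_integrable g"
  shows "square_integrable (\<lambda>z. f z + g z)"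
proof -
  have [measurable]: "f \<in> borel_measurable borel" "g \<in> borel_measurable borel"
    using f g by (auto simp: square_integrable_def)
  have "integrable circle_measure (\<lambda>z. 2 * (norm (f z))\<^sup>2 + 2 * (norm (g z))\<^sup>2)"
    using f g by (auto simp: square_integrable_def)
  then have "integrable circle_measure (\<lambda>z. (norm (f z + g z))\<^sup>2)"
  proof (rule Bochner_Integration.integrable_bound)
    show "AE z in circle_measure. norm ((norm (f z + g z))\<^sup>2)
        \<le> norm (2 * (norm (f z))\<^sup>2 + 2 * (norm (g z))\<^sup>2)"
    proof (rule AE_I2)
      fix z
      have "(norm (f z + g z))\<^sup>2 \<le> (norm (f z) + norm (g z))\<^sup>2"
        by (intro power_mono norm_triangle_ineq) simp
      also have "\<dots> \<le> 2 * (norm (f z))\<^sup>2 + 2 * (norm (g z))\<^sup>2"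
        using zero_le_power2[of "norm (f z) - norm (g z)"] by (simp add: power2_eq_square algebra_simps)
      finally show "norm ((norm (f z + g z))\<^sup>2)
        \<le> norm (2 * (norm (f z))\<^sup>2 + 2 * (norm (g z))\<^sup>2)" by simp
    qed
  qed simp
  then show ?thesis by (simp add: square_integrable_def)
qed

lemma square_integrable_mult_cnj:
  assumes f: "square_integrable f" and g: "square_integrable g"
  shows "integrable circle_measure (\<lambda>z. f z * cnj (g z))"
proof -
  have [measurable]: "f \<in> borel_measurable borel" "g \<in> borel_measurable borel"
    using f g by (auto simp: square_integrable_def)
  have [measurable]: "cnj \<in> borel_measurable borel"
    by (intro borel_measurable_continuous_onI continuous_intros)
  have "integrable circle_measure (\<lambda>z. (norm (f z))\<^sup>2 + (norm (g z))\<^sup>2)"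
    using f g by (auto simp: square_integrable_def)
  then show ?thesis
  proof (rule Bochner_Integration.integrable_bound)
    show "AE z in circle_measure. norm (f z * cnj (g z))
        \<le> norm ((norm (f z))\<^sup>2 + (norm (g z))\<^sup>2)"
    proof (rule AE_I2)
      fix z
      have "norm (f z) * norm (g z) \<le> (norm (f z))\<^sup>2 + (norm (g z))\<^sup>2"
        using zero_le_power2[of "norm (f z) - norm (g z)"]
          mult_nonneg_nonneg[OF norm_ge_zero[of "f z"] norm_ge_zero[of "g z"]]
        unfolding power2_diff by linarith
      then show "norm (f z * cnj (g z)) \<le> norm ((norm (f z))\<^sup>2 + (norm (g z))\<^sup>2)"
        by (simp add: norm_mult)
    qed
  qed simp
qed

definition ae_equal :: "(complex \<Rightarrow> complex) \<Rightarrow> (complex \<Rightarrow> complex) \<Rightarrow> bool" where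
  "ae_equal f g \<longleftrightarrow>
     square_integrable f \<and> square_integrable g \<and> (AE z in circle_measure. f z = g z)"

quotient_type l2T = "complex \<Rightarrow> complex" / partial: ae_equal
proof (rule part_equivpI)
  show "\<exists>f. ae_equal f f"
    by (rule exI[of _ "\<lambda>z. 0"]) (simp add: ae_equal_def square_integrable_zero)
  show "symp ae_equal"
    by (rule sympI) (auto simp: ae_equal_def eq_commute)
  show "transp ae_equal"
  proof (rule transpI)
    fix f g h assume fg: "ae_equal f g" and gh: "ae_equal g h"
    have "AE z in circle_measure. f z = g z" "AE z in circle_measure. g z = h z"
      using fg gh by (auto simp: ae_equal_def)
    then have "AE z in circle_measure. f z = h z" by eventually_elim simp
    with fg gh show "ae_equal f h" by (auto simp: ae_equal_def)
  qed
qed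

lift_definition scaleC :: "complex \<Rightarrow> l2T \<Rightarrow> l2T" is "\<lambda>a f z. a * f z"
  by (auto simp: ae_equal_def square_integrable_scale)

text \<open>The complex inner product is linear in its first argument.\<close>

lift_definition cinner :: "l2T \<Rightarrow> l2T \<Rightarrow> complex"
  is "\<lambda>f g. \<integral>z. f z * cnj (g z) \<partial>circle_measure"
proof -
  fix f f' g g' assume "ae_equal f f'" "ae_equal g g'"
  then have "AE z in circle_measure. f z = f' z" "AE z in circle_measure. g z = g' z"
    and [measurable]: "f \<in> borel_measurable borel" "f' \<in> borel_measurable borel"
      "g \<in> borel_measurable borel" "g' \<in> borel_measurable borel"
    by (auto simp: ae_equal_def square_integrable_def)
  have [measurable]: "cnj \<in> borel_measurable borel"
    by (intro borel_measurable_continuous_onI continuous_intros)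
  from \<open>AE z in circle_measure. f z = f' z\<close> \<open>AE z in circle_measure. g z = g' z\<close>
  have "AE z in circle_measure. f z * cnj (g z) = f' z * cnj (g' z)" by eventually_elim simp
  then show "(\<integral>z. f z * cnj (g z) \<partial>circle_measure) = (\<integral>z. f' z * cnj (g' z) \<partial>circle_measure)"
    by (intro integral_cong_AE) auto
qed

text \<open>
  The underlying real Hilbert space structure, with inner product the real part of the complex one;
  it provides the norm and the topology.
\<close>

instantiation l2T :: real_inner
begin

lift_definition zero_l2T :: l2T is "\<lambda>z. 0"
  by (simp add: ae_equal_def square_integrable_zero)

lift_definition plus_l2T :: "l2T \<Rightarrow> l2T \<Rightarrow> l2T" is "\<lambda>f g z. f z + g z"
proof -
  fix f f' g g' assume fg: "ae_equal f f'" "ae_equal g g'"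
  then have "AE z in circle_measure. f z = f' z" "AE z in circle_measure. g z = g' z"
    by (auto simp: ae_equal_def)
  then have "AE z in circle_measure. f z + g z = f' z + g' z" by eventually_elim simp
  then show "ae_equal (\<lambda>z. f z + g z) (\<lambda>z. f' z + g' z)"
    using fg by (auto simp: ae_equal_def square_integrable_add)
qed

definition uminus_l2T :: "l2T \<Rightarrow> l2T" where "uminus_l2T f = scaleC (- 1) f"

definition minus_l2T :: "l2T \<Rightarrow> l2T \<Rightarrow> l2T" where "minus_l2T f g = f + scaleC (- 1) g"

definition scaleR_l2T :: "real \<Rightarrow> l2T \<Rightarrow> l2T" where "scaleR_l2T r f = scaleC (of_real r) f"

definition inner_l2T :: "l2T \<Rightarrow> l2T \<Rightarrow> real" where "inner_l2T f g = Re (cinner f g)"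

definition norm_l2T :: "l2T \<Rightarrow> real" where "norm_l2T f = sqrt (inner f f)"

definition sgn_l2T :: "l2T \<Rightarrow> l2T" where "sgn_l2T f = scaleR (inverse (norm f)) f"

definition dist_l2T :: "l2T \<Rightarrow> l2T \<Rightarrow> real" where "dist_l2T f g = norm (f - g)"

definition uniformity_l2T :: "(l2T \<times> l2T) filter" where
  "uniformity_l2T = (INF e\<in>{0<..}. principal {(f, g). dist f g < e})"

definition open_l2T :: "l2T set \<Rightarrow> bool" where
  "open_l2T U \<longleftrightarrow> (\<forall>f\<in>U. eventually (\<lambda>(f', g). f' = f \<longrightarrow> g \<in> U) uniformity)"

instance
proof
  fix f g h :: l2T and r s :: real
  show "f + g + h = f + (g + h)"
    by transfer (simp add: ae_equal_def square_integrable_add add.assoc)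
  show "f + g = g + f"
    by transfer (simp add: ae_equal_def square_integrable_add add.commute)
  show "0 + f = f"
    by transfer (simp add: ae_equal_def)
  show "- f + f = 0"
    unfolding uminus_l2T_def by transfer (simp add: ae_equal_def square_integrable_zero)
  show "f - g = f + - g"
    by (simp add: uminus_l2T_def minus_l2T_def)
  show "r *\<^sub>R (f + g) = r *\<^sub>R f + r *\<^sub>R g"
    unfolding scaleR_l2T_def
    by transfer (simp add: ae_equal_def square_integrable_add square_integrable_scale distrib_left)
  show "(r + s) *\<^sub>R f = r *\<^sub>R f + s *\<^sub>R f"
    unfolding scaleR_l2T_def
    by transfer (simp add: ae_equal_def square_integrable_add square_integrable_scale distrib_right)
  show "r *\<^sub>R s *\<^sub>R f = (r * s) *\<^sub>R f"
    unfolding scaleR_l2T_def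
    by transfer (simp add: ae_equal_def square_integrable_scale mult.assoc)
  show "1 *\<^sub>R f = f"
    unfolding scaleR_l2T_def by transfer (simp add: ae_equal_def)
  show "sgn f = inverse (norm f) *\<^sub>R f"
    by (simp add: sgn_l2T_def)
  show "dist f g = norm (f - g)"
    by (simp add: dist_l2T_def)
  show "uniformity = (INF e\<in>{0<..}. principal {(f :: l2T, g). dist f g < e})"
    by (simp add: uniformity_l2T_def)
  show "open U = (\<forall>f\<in>U. \<forall>\<^sub>F (f', g) in uniformity. f' = f \<longrightarrow> g \<in> U)" for U :: "l2T set"
    by (simp add: open_l2T_def)
  have "cinner f g = cnj (cinner g f)"
    by transfer (simp flip: Bochner_Integration.integral_cnj add: mult.commute)
  then show "inner f g = inner g f"
    by (simp add: inner_l2T_def)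
  have "cinner (f + g) h = cinner f h + cinner g h"
    by transfer
      (simp add: ae_equal_def distrib_right square_integrable_mult_cnj Bochner_Integration.integral_add)
  then show "inner (f + g) h = inner f h + inner g h"
    by (simp add: inner_l2T_def)
  have "cinner (scaleC (of_real r) f) g = of_real r * cinner f g"
    by transfer (simp add: mult.assoc)
  then show "inner (r *\<^sub>R f) g = r * inner f g"
    by (simp add: inner_l2T_def scaleR_l2T_def)
  have sq: "cinner k k = of_real (\<integral>z. (norm (rep_l2T k z))\<^sup>2 \<partial>circle_measure)
      \<and> square_integrable (rep_l2T k)" for k
  proof -
    have k: "square_integrable (rep_l2T k)"
      using Quotient_rep_reflp[OF Quotient_l2T, of k] by (simp add: ae_equal_def)
    have "cinner k k = (\<integral>z. of_real ((norm (rep_l2T k z))\<^sup>2) \<partial>circle_measure)"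
      by (simp add: cinner.rep_eq complex_norm_square del: of_real_power)
    with k show ?thesis by (simp del: of_real_power)
  qed
  show "0 \<le> inner f f"
    using sq[of f] by (simp add: inner_l2T_def)
  show "inner f f = 0 \<longleftrightarrow> f = 0"
  proof
    assume "inner f f = 0"
    then have "(\<integral>z. (norm (rep_l2T f z))\<^sup>2 \<partial>circle_measure) = 0"
      using sq[of f] by (simp add: inner_l2T_def)
    then have "AE z in circle_measure. (norm (rep_l2T f z))\<^sup>2 = 0"
      using sq[of f] by (subst (asm) integral_nonneg_eq_0_iff_AE) (auto simp: square_integrable_def)
    then have "ae_equal (rep_l2T f) (\<lambda>z. 0)"
      using sq[of f] by (auto simp: ae_equal_def square_integrable_zero)
    then show "f = 0"
      by (metis Quotient_abs_rep[OF Quotient_l2T] Quotient_rel_abs[OF Quotient_l2T]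
          zero_l2T.abs_eq)
  next
    assume "f = 0"
    moreover have "cinner 0 0 = 0" by transfer simp
    ultimately show "inner f f = 0" by (simp add: inner_l2T_def)
  qed
  show "norm f = sqrt (inner f f)"
    by (simp add: norm_l2T_def)
qed

end

section \<open>Fourier coefficients, Hardy space, bounded functions\<close>

lemma power_int_measurable: "(\<lambda>z::complex. z powi k) \<in> borel_measurable borel"
  by (cases "k \<ge> 0") (simp_all add: power_int_def)

lift_definition zpow :: "int \<Rightarrow> l2T" is "\<lambda>k z. z powi k"
proof -
  fix k :: int
  have "AE z in circle_measure. norm (z powi k) \<le> 1"
    using AE_circle_norm by eventually_elim (simp add: norm_power_int)
  then show "ae_equal (\<lambda>z. z powi k) (\<lambda>z. z powi k)"
    using square_integrable_bounded[OF power_int_measurable] by (auto simp: ae_equal_def)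
qed

definition fourier_coeff :: "l2T \<Rightarrow> int \<Rightarrow> complex" where
  "fourier_coeff f k = cinner f (zpow k)"

definition H2 :: "l2T set" where
  "H2 = {f. \<forall>k<0. fourier_coeff f k = 0}"

text \<open>
  Since the measure is finite, bounded functions are square-integrable, and \<open>Linfty\<close> is
  a subset of the square-integrable ones.
\<close>

lift_definition ess_bounded :: "l2T \<Rightarrow> bool"
  is "\<lambda>f. \<exists>c. AE z in circle_measure. norm (f z) \<le> c"
proof -
  fix f g assume "ae_equal f g"
  then have fg: "AE z in circle_measure. f z = g z" by (simp add: ae_equal_def)
  have "(AE z in circle_measure. norm (f z) \<le> c) \<longleftrightarrow> (AE z in circle_measure. norm (g z) \<le> c)" for c
    using fg by (intro iffI; elim AE_mp) (auto elim: eventually_mono)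
  then show "(\<exists>c. AE z in circle_measure. norm (f z) \<le> c) = (\<exists>c. AE z in circle_measure. norm (g z) \<le> c)"
    by simp
qed

definition Linfty :: "l2T set" where
  "Linfty = {f. ess_bounded f}"

definition Hinfty :: "l2T set" where
  "Hinfty = H2 \<inter> Linfty"

section \<open>Operators\<close>

text \<open>
  Pointwise multiplication. The product of two square-integrable functions need not be
  square-integrable, in which case the value is the dummy 0; this never happens when
  \<open>\<phi>\<close> belongs to \<open>Linfty\<close>.
\<close>

lift_definition mult_op :: "l2T \<Rightarrow> l2T \<Rightarrow> l2T"
  is "\<lambda>\<phi> f. if square_integrable (\<lambda>z. \<phi> z * f z) then (\<lambda>z. \<phi> z * f z) else (\<lambda>z. 0)"
proof -
  fix p p' f f' assume a: "ae_equal p p'" "ae_equal f f'"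
  then have pf: "AE z in circle_measure. p z = p' z" "AE z in circle_measure. f z = f' z"
    and [measurable]: "p \<in> borel_measurable borel" "p' \<in> borel_measurable borel"
      "f \<in> borel_measurable borel" "f' \<in> borel_measurable borel"
    by (auto simp: ae_equal_def square_integrable_def)
  from pf have eq: "AE z in circle_measure. p z * f z = p' z * f' z" by eventually_elim simp
  then have "AE z in circle_measure. (norm (p z * f z))\<^sup>2 = (norm (p' z * f' z))\<^sup>2"
    by eventually_elim simp
  then have "integrable circle_measure (\<lambda>z. (norm (p z * f z))\<^sup>2) \<longleftrightarrow>
      integrable circle_measure (\<lambda>z. (norm (p' z * f' z))\<^sup>2)"
    by (intro integrable_cong_AE) simp_all
  then have "square_integrable (\<lambda>z. p z * f z) \<longleftrightarrow> square_integrable (\<lambda>z. p' z * f' z)"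
    by (simp add: square_integrable_def)
  with eq show "ae_equal
      (if square_integrable (\<lambda>z. p z * f z) then (\<lambda>z. p z * f z) else (\<lambda>z. 0))
      (if square_integrable (\<lambda>z. p' z * f' z) then (\<lambda>z. p' z * f' z) else (\<lambda>z. 0))"
    by (auto simp: ae_equal_def square_integrable_zero)
qed

lift_definition Jstar :: "l2T \<Rightarrow> l2T" is "\<lambda>f z. cnj (f (cnj z))"
proof -
  fix f g assume fg: "ae_equal f g"
  have cnj [measurable]: "cnj \<in> borel_measurable borel"
    by (intro borel_measurable_continuous_onI continuous_intros)
  have si: "square_integrable (\<lambda>z. cnj (h (cnj z)))" if h: "square_integrable h" for h
  proof -
    have [measurable]: "h \<in> borel_measurable borel" using h by (simp add: square_integrable_def)
    have "integrable (distr circle_measure borel cnj) (\<lambda>z. (norm (h z))\<^sup>2)"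
      using h by (simp add: square_integrable_def circle_measure_cnj)
    then have "integrable circle_measure (\<lambda>z. (norm (h (cnj z)))\<^sup>2)"
      by (subst (asm) integrable_distr_eq) simp_all
    then show ?thesis by (simp add: square_integrable_def)
  qed
  have [measurable]: "f \<in> borel_measurable borel" "g \<in> borel_measurable borel"
    using fg by (auto simp: ae_equal_def square_integrable_def)
  have "AE z in distr circle_measure borel cnj. f z = g z"
    using fg unfolding circle_measure_cnj ae_equal_def by blast
  then have "AE z in circle_measure. f (cnj z) = g (cnj z)"
    by (subst (asm) AE_distr_iff) simp_all
  then show "ae_equal (\<lambda>z. cnj (f (cnj z))) (\<lambda>z. cnj (g (cnj z)))"
    using fg by (auto simp: ae_equal_def si)
qed

definition conjugation :: "(l2T \<Rightarrow> l2T) \<Rightarrow> bool" where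
  "conjugation C \<longleftrightarrow>
     (\<forall>f g. C (f + g) = C f + C g) \<and>
     (\<forall>a f. C (scaleC a f) = scaleC (cnj a) (C f)) \<and>
     (\<forall>f. C (C f) = f) \<and>
     (\<forall>f g. cinner (C f) (C g) = cinner g f)"

definition bounded_clinear :: "(l2T \<Rightarrow> l2T) \<Rightarrow> bool" where
  "bounded_clinear T \<longleftrightarrow>
     (\<forall>f g. T (f + g) = T f + T g) \<and>
     (\<forall>a f. T (scaleC a f) = scaleC a (T f)) \<and>
     (\<exists>K. \<forall>f. norm (T f) \<le> K * norm f)"

text \<open>The Hilbert space adjoint; only meaningful for bounded linear operators.\<close>

definition cadjoint :: "(l2T \<Rightarrow> l2T) \<Rightarrow> l2T \<Rightarrow> l2T" where
  "cadjoint T = (THE S. \<forall>f g. cinner (T f) g = cinner f (S g))"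

definition C_symmetric :: "(l2T \<Rightarrow> l2T) \<Rightarrow> (l2T \<Rightarrow> l2T) \<Rightarrow> bool" where
  "C_symmetric C T \<longleftrightarrow> bounded_clinear T \<and> C \<circ> T \<circ> C = cadjoint T"

definition unitary_op :: "(l2T \<Rightarrow> l2T) \<Rightarrow> bool" where
  "unitary_op U \<longleftrightarrow> bounded_clinear U \<and> cadjoint U \<circ> U = id \<and> U \<circ> cadjoint U = id"

text \<open>
  \<open>component n i f\<close> is the sum, in the norm topology, of the terms of the Fourier series of \<open>f\<close>
  whose exponent is congruent to \<open>i - 1\<close> modulo \<open>n\<close>.
\<close>

definition component :: "nat \<Rightarrow> nat \<Rightarrow> l2T \<Rightarrow> l2T" where
  "component n i f =
     (\<Sum>\<^sub>\<infinity>k\<in>(UNIV :: int set).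
        scaleC (fourier_coeff f (int n * k + int i - 1)) (zpow (int n * k + int i - 1)))"

text \<open>Only the values \<open>\<phi> 1, \<dots>, \<phi> n\<close> of the family matter.\<close>

definition block_mult_op :: "nat \<Rightarrow> (nat \<Rightarrow> l2T) \<Rightarrow> l2T \<Rightarrow> l2T" where
  "block_mult_op n \<phi> f = (\<Sum>i=1..n. mult_op (\<phi> i) (component n i f))"

end

theory Submission
  imports Defs
begin

text \<open>
  The operator \<open>U = C \<circ> J\<^sup>\<star>\<close> is a linear isometry commuting with \<open>M\<close> of \<open>z\<^sup>n\<close>. Put \<open>g\<^sub>i = U z\<^bsup>i-1\<^esup>\<close> and
  \<open>\<xi>\<^sub>i = z\<^bsup>1-i\<^esup> g\<^sub>i\<close>. On exponents congruent to \<open>i - 1\<close> modulo \<open>n\<close>, \<open>U\<close> agrees with multiplication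
  by \<open>\<xi>\<^sub>i\<close> on monomials, hence on all of the \<open>i\<close>-th component. For boundedness let \<open>E\<close> be a set
  invariant under rotation by the \<open>n\<close>-th roots of unity. Then \<open>1\<^sub>E z\<^bsup>i-1\<^esup>\<close> lies in the \<open>i\<close>-th component,
  so the integral of \<open>\<bar>g\<^sub>i\<bar>\<^sup>2\<close> over \<open>E\<close> is the measure of \<open>E\<close>. Applied to the set where the sum of
  \<open>\<bar>g\<^sub>i\<bar>\<^sup>2\<close> over the rotates exceeds \<open>n\<close>, this shows that \<open>\<bar>g\<^sub>i\<bar>\<^sup>2 \<le> n\<close> almost everywhere.
\<close>

lemma cnj_borel_measurable [measurable]: "cnj \<in> borel_measurable borel"
  by (intro borel_measurable_continuous_onI continuous_intros)

section \<open>Representatives\<close>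

lemma square_integrable_rep [simp, intro]: "square_integrable (rep_l2T f)"
  using Quotient_rep_reflp[OF Quotient_l2T, of f] by (simp add: ae_equal_def)

lemma rep_borel_measurable [measurable]: "rep_l2T f \<in> borel_measurable borel"
  using square_integrable_rep square_integrable_def by blast

lemma abs_rep_l2T [simp]: "abs_l2T (rep_l2T f) = f"
  by (rule Quotient_abs_rep[OF Quotient_l2T])

lemma rep_abs_AE:
  assumes "square_integrable f"
  shows "AE z in circle_measure. rep_l2T (abs_l2T f) z = f z"
proof -
  have "ae_equal f f" using assms by (simp add: ae_equal_def)
  then have "ae_equal (rep_l2T (abs_l2T f)) f"
    by (rule Quotient_rep_abs[OF Quotient_l2T])
  then show ?thesis by (simp add: ae_equal_def)
qed

lemma abs_l2T_eqI:
  assumes "square_integrable f" "square_integrable g" "AE z in circle_measure. f z = g z"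
  shows "abs_l2T f = abs_l2T g"
  using assms Quotient_rel_abs[OF Quotient_l2T] by (simp add: ae_equal_def)

lemma l2T_eqI: "AE z in circle_measure. rep_l2T f z = rep_l2T g z \<Longrightarrow> f = g"
  using abs_l2T_eqI[of "rep_l2T f" "rep_l2T g"] by simp

lemma rep_add_AE: "AE z in circle_measure. rep_l2T (f + g) z = rep_l2T f z + rep_l2T g z"
  unfolding plus_l2T_def map_fun_apply
  by (rule rep_abs_AE) (simp add: square_integrable_add)

lemma rep_scaleC_AE: "AE z in circle_measure. rep_l2T (scaleC a f) z = a * rep_l2T f z"
  unfolding scaleC_def map_fun_apply id_apply
  by (rule rep_abs_AE) (simp add: square_integrable_scale)

lemma rep_zero_AE: "AE z in circle_measure. rep_l2T 0 z = 0"
  unfolding zero_l2T_def by (rule rep_abs_AE) (rule square_integrable_zero)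

lemma rep_diff_AE: "AE z in circle_measure. rep_l2T (f - g) z = rep_l2T f z - rep_l2T g z"
  using rep_add_AE[of f "scaleC (- 1) g"] rep_scaleC_AE[of "- 1" g]
  unfolding minus_l2T_def by eventually_elim simp

lemma square_integrable_powi: "square_integrable (\<lambda>z. z powi k)"
proof -
  have "AE z in circle_measure. norm (z powi k) \<le> 1"
    using AE_circle_norm by eventually_elim (simp add: norm_power_int)
  then show ?thesis using square_integrable_bounded[OF power_int_measurable] by blast
qed

lemma rep_zpow_AE: "AE z in circle_measure. rep_l2T (zpow k) z = z powi k"
  unfolding zpow_def map_fun_apply id_apply by (rule rep_abs_AE) (rule square_integrable_powi)

lemma square_integrable_cnj_cnj:
  assumes h: "square_integrable h"
  shows "square_integrable (\<lambda>z. cnj (h (cnj z)))"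
proof -
  have [measurable]: "h \<in> borel_measurable borel" using h by (simp add: square_integrable_def)
  have "integrable (distr circle_measure borel cnj) (\<lambda>z. (norm (h z))\<^sup>2)"
    using h by (simp add: square_integrable_def circle_measure_cnj)
  then have "integrable circle_measure (\<lambda>z. (norm (h (cnj z)))\<^sup>2)"
    by (subst (asm) integrable_distr_eq) simp_all
  then show ?thesis by (simp add: square_integrable_def)
qed

lemma rep_Jstar_AE: "AE z in circle_measure. rep_l2T (Jstar f) z = cnj (rep_l2T f (cnj z))"
  unfolding Jstar_def map_fun_apply by (rule rep_abs_AE) (simp add: square_integrable_cnj_cnj)

text \<open>The exceptional null set is carried to a null set because \<open>cnj\<close> preserves
  \<open>circle_measure\<close>.\<close>

lemma AE_cnj:
  assumes [measurable]: "Measurable.pred borel P" and "AE z in circle_measure. P z"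
  shows "AE z in circle_measure. P (cnj z)"
proof -
  have "AE z in distr circle_measure borel cnj. P z"
    unfolding circle_measure_cnj by (rule assms)
  then show ?thesis by (subst (asm) AE_distr_iff) simp_all
qed

lemma square_integrable_cong_AE:
  assumes "AE z in circle_measure. f z = g z" "g \<in> borel_measurable borel" "square_integrable f"
  shows "square_integrable g"
proof -
  have [measurable]: "f \<in> borel_measurable borel" "g \<in> borel_measurable borel"
    using assms by (auto simp: square_integrable_def)
  have "integrable circle_measure (\<lambda>z. (norm (f z))\<^sup>2) \<longleftrightarrow>
      integrable circle_measure (\<lambda>z. (norm (g z))\<^sup>2)"
  proof (rule integrable_cong_AE)
    show "AE z in circle_measure. (norm (f z))\<^sup>2 = (norm (g z))\<^sup>2"
      using assms(1) by eventually_elim simp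
  qed simp_all
  with assms show ?thesis by (auto simp: square_integrable_def)
qed

text \<open>\<open>mult_op\<close> falls back to 0 when the product is not square-integrable. Here
  the product agrees a.e. with a representative of \<open>h\<close>, which is square-integrable, so
  the genuine branch is taken without any bound on \<open>p\<close>.\<close>

lemma mult_op_eqI:
  assumes "AE z in circle_measure. rep_l2T h z = rep_l2T p z * rep_l2T f z"
  shows "mult_op p f = h"
proof -
  have si: "square_integrable (\<lambda>z. rep_l2T p z * rep_l2T f z)"
    by (rule square_integrable_cong_AE[OF assms]) auto
  have "mult_op p f = abs_l2T (\<lambda>z. rep_l2T p z * rep_l2T f z)"
    using si by (simp add: mult_op_def)
  also have "\<dots> = abs_l2T (rep_l2T h)"
  proof (rule abs_l2T_eqI)
    show "AE z in circle_measure. rep_l2T p z * rep_l2T f z = rep_l2T h z"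
      using assms by eventually_elim simp
  qed (use si in simp_all)
  finally show ?thesis by simp
qed

text \<open>Powers of z have modulus 1 on the circle, so the product has the same square integral as
  \<open>f\<close> and the default value of \<open>mult_op\<close> never occurs.\<close>

lemma rep_mult_zpow_AE:
  "AE z in circle_measure. rep_l2T (mult_op (zpow k) f) z = z powi k * rep_l2T f z"
proof -
  let ?h = "\<lambda>z. z powi k * rep_l2T f z"
  have [measurable]: "(\<lambda>z::complex. z powi k) \<in> borel_measurable borel"
    by (rule power_int_measurable)
  have "AE z in circle_measure. (norm (?h z))\<^sup>2 = (norm (rep_l2T f z))\<^sup>2"
    using AE_circle_norm by eventually_elim (simp add: norm_mult norm_power_int)
  then have "integrable circle_measure (\<lambda>z. (norm (?h z))\<^sup>2) \<longleftrightarrow>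
      integrable circle_measure (\<lambda>z. (norm (rep_l2T f z))\<^sup>2)"
    by (intro integrable_cong_AE) simp_all
  then have si: "square_integrable ?h"
    using square_integrable_rep[of f] by (simp add: square_integrable_def)
  have "AE z in circle_measure. rep_l2T (abs_l2T ?h) z = rep_l2T (zpow k) z * rep_l2T f z"
    using rep_abs_AE[OF si] rep_zpow_AE[of k] by eventually_elim simp
  from mult_op_eqI[OF this] rep_abs_AE[OF si] show ?thesis by simp
qed

section \<open>The inner product\<close>

lemma cinner_add_left: "cinner (f + g) h = cinner f h + cinner g h"
  by transfer
    (simp add: ae_equal_def distrib_right square_integrable_mult_cnj Bochner_Integration.integral_add)

lemma cinner_scaleC_left: "cinner (scaleC a f) g = a * cinner f g"
  by transfer (simp add: mult.assoc)

lemma cinner_commute: "cinner f g = cnj (cinner g f)"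
  by transfer (simp flip: Bochner_Integration.integral_cnj add: mult.commute)

lemma cinner_add_right: "cinner f (g + h) = cinner f g + cinner f h"
  by (metis cinner_add_left cinner_commute complex_cnj_add)

lemma cinner_scaleC_right: "cinner f (scaleC a g) = cnj a * cinner f g"
  by (metis cinner_scaleC_left cinner_commute complex_cnj_mult)

lemma scaleC_add_right: "scaleC a (f + g) = scaleC a f + scaleC a g"
  by transfer (simp add: ae_equal_def square_integrable_add square_integrable_scale distrib_left)

lemma scaleC_add_left: "scaleC (a + b) f = scaleC a f + scaleC b f"
  by transfer (simp add: ae_equal_def square_integrable_add square_integrable_scale distrib_right)

lemma scaleC_scaleC: "scaleC a (scaleC b f) = scaleC (a * b) f"
  by transfer (simp add: ae_equal_def square_integrable_scale mult.assoc)

lemma scaleC_one [simp]: "scaleC 1 f = f"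
  by transfer (simp add: ae_equal_def)

lemma scaleC_zero_left [simp]: "scaleC 0 f = 0"
  by transfer (simp add: ae_equal_def square_integrable_zero)

lemma scaleC_zero_right [simp]: "scaleC a 0 = 0"
  by transfer (simp add: ae_equal_def square_integrable_zero)

lemma scaleR_eq_scaleC: "r *\<^sub>R f = scaleC (of_real r) f"
  by (simp add: scaleR_l2T_def)

lemma scaleC_scaleR: "scaleC a (r *\<^sub>R f) = r *\<^sub>R scaleC a f"
  by (simp add: scaleR_l2T_def scaleC_scaleC mult.commute)

lemma cinner_zero_left [simp]: "cinner 0 g = 0"
  using cinner_scaleC_left[of 0 0 g] by simp

lemma cinner_zero_right [simp]: "cinner g 0 = 0"
  using cinner_scaleC_right[of g 0 0] by simp

lemma cinner_diff_left: "cinner (f - g) h = cinner f h - cinner g h"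
  by (simp add: minus_l2T_def cinner_add_left cinner_scaleC_left)

lemma cinner_diff_right: "cinner h (f - g) = cinner h f - cinner h g"
  by (simp add: minus_l2T_def cinner_add_right cinner_scaleC_right)

lemma cinner_sum_left: "cinner (sum f A) g = (\<Sum>x\<in>A. cinner (f x) g)"
  by (induction A rule: infinite_finite_induct) (simp_all add: cinner_add_left)

lemma cinner_sum_right: "cinner g (sum f A) = (\<Sum>x\<in>A. cinner g (f x))"
  by (induction A rule: infinite_finite_induct) (simp_all add: cinner_add_right)

lemma cinner_rep: "cinner f g = (\<integral>z. rep_l2T f z * cnj (rep_l2T g z) \<partial>circle_measure)"
  by (simp add: cinner.rep_eq)

lemma norm_l2T_power2: "(norm f)\<^sup>2 = (\<integral>z. (norm (rep_l2T f z))\<^sup>2 \<partial>circle_measure)"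
proof -
  have "cinner f f = (\<integral>z. of_real ((norm (rep_l2T f z))\<^sup>2) \<partial>circle_measure)"
    by (simp add: cinner_rep complex_norm_square del: of_real_power)
  also have "\<dots> = of_real (\<integral>z. (norm (rep_l2T f z))\<^sup>2 \<partial>circle_measure)"
    by (rule integral_complex_of_real)
  finally show ?thesis
    by (simp add: power2_norm_eq_inner inner_l2T_def)
qed

lemma norm_scaleC: "norm (scaleC a f) = norm a * norm f"
proof -
  have "(norm (scaleC a f))\<^sup>2 = (norm a * norm f)\<^sup>2"
    unfolding power2_norm_eq_inner power_mult_distrib inner_l2T_def cinner_scaleC_left cinner_scaleC_right
    by (simp add: cmod_power2 mult.assoc[symmetric] complex_mult_cnj inner_complex_def power2_eq_square del: of_real_power)
  then show ?thesis by simp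
qed

lemma norm_eq_of_cinner: "cinner f f = cinner g g \<Longrightarrow> norm f = norm g"
  by (simp add: norm_l2T_def inner_l2T_def)

lemma norm_abs_power2:
  assumes "square_integrable f"
  shows "(norm (abs_l2T f))\<^sup>2 = (\<integral>z. (norm (f z))\<^sup>2 \<partial>circle_measure)"
proof -
  have [measurable]: "f \<in> borel_measurable borel" using assms by (simp add: square_integrable_def)
  show ?thesis unfolding norm_l2T_power2
  proof (rule integral_cong_AE)
    show "AE z in circle_measure. (norm (rep_l2T (abs_l2T f) z))\<^sup>2 = (norm (f z))\<^sup>2"
      using rep_abs_AE[OF assms] by eventually_elim simp
  qed simp_all
qed

lemma abs_l2T_add:
  assumes "square_integrable f" "square_integrable g"
  shows "abs_l2T (\<lambda>z. f z + g z) = abs_l2T f + abs_l2T g"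
  using assms by (simp add: ae_equal_def plus_l2T.abs_eq)

lemma abs_l2T_scale:
  assumes "square_integrable f"
  shows "abs_l2T (\<lambda>z. a * f z) = scaleC a (abs_l2T f)"
  using assms by (simp add: ae_equal_def scaleC.abs_eq)

text \<open>Cauchy-Schwarz for the real inner product, applied to the classes of the absolute values
  of both functions: they have the same norms, and their inner product is the integral on the
  left.\<close>

lemma integral_norm_mult_le:
  "(\<integral>z. norm (rep_l2T f z * rep_l2T g z) \<partial>circle_measure) \<le> norm f * norm g"
proof -
  have si: "square_integrable (\<lambda>z. complex_of_real (norm (rep_l2T h z)))" for h
    using square_integrable_rep[of h] by (simp add: square_integrable_def)
  let ?F = "\<lambda>h. abs_l2T (\<lambda>z. complex_of_real (norm (rep_l2T h z)))"
  have n: "norm (?F h) = norm h" for h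
  proof -
    have "(norm (?F h))\<^sup>2 = (norm h)\<^sup>2"
      by (simp add: norm_abs_power2[OF si] norm_l2T_power2[of h])
    then show ?thesis by simp
  qed
  have "cinner (?F f) (?F g) = (\<integral>z. of_real (norm (rep_l2T f z * rep_l2T g z)) \<partial>circle_measure)"
    unfolding cinner_rep
  proof (rule integral_cong_AE)
    show "AE z in circle_measure. rep_l2T (?F f) z * cnj (rep_l2T (?F g) z)
        = complex_of_real (norm (rep_l2T f z * rep_l2T g z))"
      using rep_abs_AE[OF si[of f]] rep_abs_AE[OF si[of g]]
      by eventually_elim (simp add: norm_mult)
  qed simp_all
  also have "\<dots> = of_real (\<integral>z. norm (rep_l2T f z * rep_l2T g z) \<partial>circle_measure)"
    by (rule integral_complex_of_real)
  finally have "inner (?F f) (?F g) = (\<integral>z. norm (rep_l2T f z * rep_l2T g z) \<partial>circle_measure)"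
    by (simp add: inner_l2T_def)
  then show ?thesis using norm_cauchy_schwarz[of "?F f" "?F g"] by (simp add: n)
qed

text \<open>Dominated convergence in the norm of \<open>l2T\<close>: the squared distance is an
  integral whose integrand is at most \<open>4 * (norm (w z))\<^sup>2\<close>.\<close>

lemma abs_l2T_tendsto:
  assumes s: "\<And>i. s i \<in> borel_measurable borel" and f: "f \<in> borel_measurable borel"
    and w: "square_integrable w"
    and bound: "\<And>i z. norm (s i z) \<le> norm (w z)"
    and lim: "\<And>z. (\<lambda>i. s i z) \<longlonglongrightarrow> f z"
  shows "square_integrable f" "square_integrable (s i)" "(\<lambda>i. abs_l2T (s i)) \<longlonglongrightarrow> abs_l2T f"
proof -
  note [measurable] = s f
  have [measurable]: "w \<in> borel_measurable borel" using w by (simp add: square_integrable_def)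
  have intw: "integrable circle_measure (\<lambda>z. (norm (w z))\<^sup>2)" 
    using w by (simp add: square_integrable_def)
  have bf: "norm (f z) \<le> norm (w z)" for z
    by (rule LIMSEQ_le_const2[OF tendsto_norm[OF lim]]) (use bound in auto)
  have sq: "square_integrable h"
    if "h \<in> borel_measurable borel" and "\<And>z. norm (h z) \<le> norm (w z)" for h
  proof -
    have "integrable circle_measure (\<lambda>z. (norm (h z))\<^sup>2)"
    proof (rule Bochner_Integration.integrable_bound[OF intw])
      show "AE z in circle_measure. norm ((norm (h z))\<^sup>2) \<le> norm ((norm (w z))\<^sup>2)"
        using power_mono[OF that(2) norm_ge_zero] by simp
      show "(\<lambda>z. (norm (h z))\<^sup>2) \<in> borel_measurable circle_measure"
        using that(1) by simp
    qed
    with that show ?thesis by (simp add: square_integrable_def)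
  qed
  show si: "square_integrable f" "square_integrable (s i)" for i
    using sq[OF f bf] sq[OF s bound] by blast+
  have d: "square_integrable (\<lambda>z. s i z - f z)" for i
    using square_integrable_add[OF si(2) square_integrable_scale[OF si(1), of "-1"]] by simp
  have "(norm (abs_l2T (s i) - abs_l2T f))\<^sup>2 = (\<integral>z. (norm (s i z - f z))\<^sup>2 \<partial>circle_measure)" for i
  proof -
    have "abs_l2T (s i) - abs_l2T f = abs_l2T (\<lambda>z. s i z - f z)"
      using abs_l2T_add[OF si(2)[of i] square_integrable_scale[OF si(1), of "-1"]]
        abs_l2T_scale[OF si(1), of "-1"] by (simp add: minus_l2T_def)
    then show ?thesis by (simp add: norm_abs_power2[OF d])
  qed
  moreover have "(\<lambda>i. \<integral>z. (norm (s i z - f z))\<^sup>2 \<partial>circle_measure) \<longlonglongrightarrow> (\<integral>z. 0 \<partial>circle_measure)"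
  proof (rule integral_dominated_convergence[where w = "\<lambda>z. 4 * (norm (w z))\<^sup>2"])
    show "integrable circle_measure (\<lambda>z. 4 * (norm (w z))\<^sup>2)" using intw by simp
    show "AE z in circle_measure. (\<lambda>i. (norm (s i z - f z))\<^sup>2) \<longlonglongrightarrow> 0"
    proof (rule AE_I2)
      fix z
      have "(\<lambda>i. (norm (s i z - f z))\<^sup>2) \<longlonglongrightarrow> (norm (f z - f z))\<^sup>2"
        by (intro tendsto_intros lim)
      then show "(\<lambda>i. (norm (s i z - f z))\<^sup>2) \<longlonglongrightarrow> 0" by simp
    qed
    show "AE z in circle_measure. norm ((norm (s i z - f z))\<^sup>2) \<le> 4 * (norm (w z))\<^sup>2" for i
    proof (rule AE_I2)
      fix z
      have "norm (s i z - f z) \<le> 2 * norm (w z)"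
        using norm_triangle_ineq4[of "s i z" "f z"] bound[of i z] bf[of z] by linarith
      then have "(norm (s i z - f z))\<^sup>2 \<le> (2 * norm (w z))\<^sup>2" by (rule power_mono) simp
      then show "norm ((norm (s i z - f z))\<^sup>2) \<le> 4 * (norm (w z))\<^sup>2"
        by (simp add: power_mult_distrib)
    qed
  qed simp_all
  ultimately have "(\<lambda>i. (norm (abs_l2T (s i) - abs_l2T f))\<^sup>2) \<longlonglongrightarrow> 0" by simp
  then have "(\<lambda>i. norm (abs_l2T (s i) - abs_l2T f)) \<longlonglongrightarrow> 0"
    by (simp add: tendsto_null_power)
  then show "(\<lambda>i. abs_l2T (s i)) \<longlonglongrightarrow> abs_l2T f"
    by (simp add: LIM_zero_cancel tendsto_norm_zero_iff)
qed

section \<open>Rotations\<close>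

lemma emeasure_lborel_translate:
  fixes X :: "real set"
  assumes "X \<in> sets borel"
  shows "emeasure lborel ((+) t -` X) = emeasure lborel X"
proof -
  have "emeasure lborel X = emeasure (distr lborel borel ((+) t)) X" by (simp add: lborel_distr_plus)
  also have "\<dots> = emeasure lborel ((+) t -` X)" using assms by (subst emeasure_distr) auto
  finally show ?thesis by simp
qed

text \<open>Rotation by \<open>cis t\<close> is translation of the angle by t. The set of angles
  \<open>B\<close> is periodic with period 2 pi, so a translated window of that length contains as
  much of \<open>B\<close> as the original one.\<close>

lemma circle_measure_rotate:
  fixes w :: complex
  assumes "norm w = 1"
  shows "distr circle_measure borel ((*) w) = circle_measure"
proof (rule measure_eqI)
  fix A assume "A \<in> sets (distr circle_measure borel ((*) w))"
  then have A [measurable]: "A \<in> sets borel" by simp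
  obtain t where t: "0 \<le> t" "t < 2 * pi" and w: "w = cis t"
    using complex_unimodular_polar[OF assms] by (metis cis.code)
  define B where "B = cis -` A"
  have B [measurable]: "B \<in> sets borel"
    unfolding B_def using measurable_sets[OF cis_borel_measurable A] by simp
  have per: "x + 2 * pi \<in> B \<longleftrightarrow> x \<in> B" for x
  proof -
    have "cis (x + 2 * pi) = cis x" by (simp add: complex_eq_iff)
    then show ?thesis by (simp add: B_def)
  qed
  \<comment> \<open>Half-open, so that pieces cut from translates fit together without overlap. The
    measure is defined on the closed interval; \<open>cl\<close> passes between the two by dropping
    the null point -pi.\<close>
  define I where "I = {- pi<..pi}"
  have cl: "emeasure lborel ({- pi..pi} \<inter> X) = emeasure lborel (I \<inter> X)"
    if [measurable]: "X \<in> sets borel" for X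
  proof (rule emeasure_eq_AE)
    have "AE x in lborel. x \<noteq> - pi" by (rule AE_lborel_singleton)
    then show "AE x in lborel. x \<in> {- pi..pi} \<inter> X \<longleftrightarrow> x \<in> I \<inter> X"
      by eventually_elim (auto simp: I_def)
  qed (auto simp: I_def)
  have [measurable]: "((+) t) -` B \<in> sets borel"
    using measurable_sets[of "(+) t" borel borel B] by simp
  have "emeasure lborel (I \<inter> ((+) t -` B)) = emeasure lborel ((+) t -` ({- pi + t<..pi + t} \<inter> B))"
    by (rule arg_cong[where f = "emeasure lborel"]) (auto simp: I_def)
  also have "\<dots> = emeasure lborel ({- pi + t<..pi + t} \<inter> B)"
    by (rule emeasure_lborel_translate) auto
  \<comment> \<open>Since 0 <= t < 2 pi, the point pi lies in the shifted window. The part beyond pi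
    is moved back by one period below and fills the gap at the left end of \<open>I\<close>.\<close>
  also have "{- pi + t<..pi + t} \<inter> B = ({- pi + t<..pi} \<inter> B) \<union> ({pi<..pi + t} \<inter> B)"
    using t by auto
  also have "emeasure lborel \<dots> = emeasure lborel ({- pi + t<..pi} \<inter> B) + emeasure lborel ({pi<..pi + t} \<inter> B)"
    by (rule plus_emeasure[symmetric]) auto
  also have "emeasure lborel ({pi<..pi + t} \<inter> B)
      = emeasure lborel ((+) (2 * pi) -` ({pi<..pi + t} \<inter> B))"
    by (rule emeasure_lborel_translate[symmetric]) auto
  also have "(+) (2 * pi) -` ({pi<..pi + t} \<inter> B) = {- pi<..- pi + t} \<inter> B"
  proof (rule set_eqI)
    fix x
    show "x \<in> (+) (2 * pi) -` ({pi<..pi + t} \<inter> B) \<longleftrightarrow> x \<in> {- pi<..- pi + t} \<inter> B"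
      using per[of x] by (simp add: add.commute[of "2 * pi" x]) linarith
  qed
  also have "emeasure lborel ({- pi + t<..pi} \<inter> B) + emeasure lborel ({- pi<..- pi + t} \<inter> B)
      = emeasure lborel (({- pi + t<..pi} \<inter> B) \<union> ({- pi<..- pi + t} \<inter> B))"
    by (rule plus_emeasure) auto
  also have "({- pi + t<..pi} \<inter> B) \<union> ({- pi<..- pi + t} \<inter> B) = I \<inter> B"
    using t by (auto simp: I_def)
  finally have eq: "emeasure lborel (I \<inter> ((+) t -` B)) = emeasure lborel (I \<inter> B)" .
  have meas [measurable]: "(*) w -` A \<in> sets borel"
    using measurable_sets[of "(*) w" borel borel A] by simp
  have "cis -` ((*) w -` A) = (+) t -` B"
    by (simp add: set_eq_iff B_def w cis_mult)
  then show "emeasure (distr circle_measure borel ((*) w)) A = emeasure circle_measure A"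
    using eq by (simp add: emeasure_distr circle_measure_def cl B_def[symmetric])
qed simp

section \<open>Fourier series\<close>

lemma integral_rotate:
  fixes f :: "complex \<Rightarrow> 'a :: {banach, second_countable_topology}"
  assumes "norm w = 1" and [measurable]: "f \<in> borel_measurable borel"
  shows "(\<integral>z. f (w * z) \<partial>circle_measure) = (\<integral>z. f z \<partial>circle_measure)"
proof -
  have "(\<integral>z. f z \<partial>circle_measure) = (\<integral>z. f z \<partial>distr circle_measure borel ((*) w))"
    by (simp only: circle_measure_rotate[OF assms(1)])
  also have "\<dots> = (\<integral>z. f (w * z) \<partial>circle_measure)"
    by (rule integral_distr) simp_all
  finally show ?thesis ..
qed

lemma measure_circle_UNIV: "measure circle_measure UNIV = 1"
proof -
  have "emeasure circle_measure UNIV = 1"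
    by (simp add: circle_measure_def emeasure_distr flip: ennreal_plus)
  then show ?thesis by (simp add: measure_def)
qed

lemma integral_powi:
  "(\<integral>z. z powi k \<partial>circle_measure) = (if k = 0 then 1 else 0)"
proof (cases "k = 0")
  case True
  then show ?thesis by (simp add: measure_circle_UNIV)
next
  case False
  \<comment> \<open>Rotation by \<open>?w\<close> multiplies the integrand by \<open>cis pi\<close>,
    that is by -1, so the integral equals its own negative.\<close>
  let ?w = "cis (pi / k)"
  have "?w powi k = - 1"
    using False by (simp add: cis_power_int)
  then have "(\<integral>z. z powi k \<partial>circle_measure) = - (\<integral>z. z powi k \<partial>circle_measure)"
    using integral_rotate[of ?w "\<lambda>z. z powi k", OF _ power_int_measurable]
    by (simp add: power_int_mult_distrib)
  then have "(\<integral>z. z powi k \<partial>circle_measure) = 0" by simp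
  with False show ?thesis by simp
qed

lemma cnj_powi_circle: "norm z = 1 \<Longrightarrow> cnj (z powi k) = z powi (- k)" for z :: complex
proof -
  assume "norm z = 1"
  then have "cnj z = inverse z" 
    using complex_div_cnj[of 1 z] by (simp add: inverse_eq_divide)
  then show ?thesis by (simp add: power_int_minus flip: power_int_inverse)
qed

lemma zpow_orthonormal: "cinner (zpow j) (zpow k) = (if j = k then 1 else 0)"
proof -
  have [measurable]: "(\<lambda>z::complex. z powi k) \<in> borel_measurable borel" for k
    by (rule power_int_measurable)
  have "cinner (zpow j) (zpow k) = (\<integral>z. z powi (j - k) \<partial>circle_measure)"
    unfolding cinner_rep
  proof (rule integral_cong_AE)
    show "AE z in circle_measure. rep_l2T (zpow j) z * cnj (rep_l2T (zpow k) z) = z powi (j - k)"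
      using rep_zpow_AE[of j] rep_zpow_AE[of k] AE_circle_norm
    proof eventually_elim
      fix z assume "rep_l2T (zpow j) z = z powi j" "rep_l2T (zpow k) z = z powi k" "norm z = 1"
      moreover from this have "z \<noteq> 0" by auto
      ultimately show "rep_l2T (zpow j) z * cnj (rep_l2T (zpow k) z) = z powi (j - k)"
        by (simp add: cnj_powi_circle power_int_minus power_int_diff divide_inverse del: complex_cnj_power_int)
    qed
  qed simp_all
  then show ?thesis by (simp add: integral_powi)
qed

text \<open>The total mass is 1, so a uniform bound passes to the norm with the same constant; this
  turns uniform approximation into approximation in \<open>l2T\<close>.\<close>

lemma norm_l2T_le:
  assumes "AE z in circle_measure. norm (rep_l2T f z) \<le> c" "0 \<le> c"
  shows "norm f \<le> c"
proof -
  interpret finite_measure circle_measure by (rule finite_measure_circle)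
  have "(norm f)\<^sup>2 \<le> (\<integral>z. c\<^sup>2 \<partial>circle_measure)"
    unfolding norm_l2T_power2
  proof (rule integral_mono_AE)
    show "integrable circle_measure (\<lambda>z. (norm (rep_l2T f z))\<^sup>2)"
      using square_integrable_rep[of f] by (simp add: square_integrable_def)
    show "AE z in circle_measure. (norm (rep_l2T f z))\<^sup>2 \<le> c\<^sup>2"
      using assms(1) by eventually_elim (simp add: power_mono)
  qed simp
  then show ?thesis using assms(2) by (simp add: measure_circle_UNIV power2_le_iff_abs_le)
qed

section \<open>Trigonometric polynomials and their density\<close>

text \<open>Equations are required on the circle only. This lets polynomials in the real and
  imaginary part of z qualify, since the conjugate of z equals its inverse there.\<close>

inductive trig_on_circle :: "(complex \<Rightarrow> complex) \<Rightarrow> bool" where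
  monom: "(\<And>z. norm z = 1 \<Longrightarrow> f z = a * z powi k) \<Longrightarrow> trig_on_circle f"
| add: "trig_on_circle f \<Longrightarrow> trig_on_circle g \<Longrightarrow> (\<And>z. norm z = 1 \<Longrightarrow> h z = f z + g z)
    \<Longrightarrow> trig_on_circle h"

lemma trig_mult_monom:
  assumes "trig_on_circle g" "\<And>z. norm z = 1 \<Longrightarrow> h z = a * z powi k * g z"
  shows "trig_on_circle h"
  using assms
proof (induction arbitrary: h)
  case (monom f b j)
  show ?case
  proof (rule trig_on_circle.monom[of _ "a * b" "k + j"])
    fix z :: complex assume z: "norm z = 1"
    then have "z \<noteq> 0" by auto
    then show "h z = a * b * z powi (k + j)" using monom z by (simp add: power_int_add)
  qed
next
  case (add f g f')
  have "trig_on_circle (\<lambda>z. a * z powi k * f z)" "trig_on_circle (\<lambda>z. a * z powi k * g z)"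
    by (rule add.IH, rule refl)+
  then show ?case
    by (rule trig_on_circle.add) (use add.hyps add.prems in \<open>simp add: distrib_left\<close>)
qed

lemma trig_mult:
  assumes "trig_on_circle f" "trig_on_circle g"
  shows "trig_on_circle (\<lambda>z. f z * g z)"
proof -
  have "trig_on_circle h" if "\<And>z. norm z = 1 \<Longrightarrow> h z = f z * g z" for h
    using assms(1) that
  proof (induction arbitrary: h)
    case (monom f a k)
    show ?case by (rule trig_mult_monom[OF assms(2), of _ a k]) (use monom in simp)
  next
    case (add f f' f'')
    have "trig_on_circle (\<lambda>z. f z * g z)" "trig_on_circle (\<lambda>z. f' z * g z)"
      by (rule add.IH, rule refl)+
    then show ?case
    proof (rule trig_on_circle.add)
      fix z :: complex assume "norm z = 1"
      then show "h z = f z * g z + f' z * g z"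
        using add.hyps(3) add.prems by (metis distrib_right)
    qed
  qed
  from this[of "\<lambda>z. f z * g z"] show ?thesis by simp
qed

text \<open>A real-linear function has the form a z + b cnj z, and on the circle this is a
  combination of the powers 1 and -1. Closure under products and sums does the rest.\<close>

lemma trig_real_polynomial:
  fixes p :: "complex \<Rightarrow> real"
  assumes "real_polynomial_function p"
  shows "trig_on_circle (\<lambda>z. of_real (p z))"
  using assms
proof induction
  case (linear p)
  interpret bounded_linear p by fact
  \<comment> \<open>The solution of a + b = p 1 and \<open>\<i>\<close> (a - b) = p
    \<open>\<i>\<close>.\<close>
  define a b where "a = (complex_of_real (p 1) - \<i> * p \<i>) / 2"
    and "b = (complex_of_real (p 1) + \<i> * p \<i>) / 2"
  have "of_real (p z) = a * z powi 1 + b * z powi (- 1)" if "norm z = 1" for z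
  proof -
    have "z = Re z *\<^sub>R 1 + Im z *\<^sub>R \<i>" by (simp add: complex_eq_iff)
    then have "p z = Re z * p 1 + Im z * p \<i>" by (metis add scaleR real_scaleR_def)
    moreover have "z powi (- 1) = cnj z"
      using cnj_powi_circle[OF that, of 1] by simp
    then have "a * z powi 1 + b * z powi (- 1) = of_real (Re z * p 1 + Im z * p \<i>)"
      unfolding a_def b_def by (simp only: power_int_1_right) (simp add: complex_eq_iff field_simps)
    ultimately show ?thesis by simp
  qed
  note eq = this
  have "trig_on_circle (\<lambda>z. a * z powi 1)" "trig_on_circle (\<lambda>z. b * z powi (- 1))"
    by (rule trig_on_circle.monom, rule refl)+
  then show ?case by (rule trig_on_circle.add) (rule eq)
next
  case (const c)
  show ?case by (rule trig_on_circle.monom[of _ "of_real c" 0]) simp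
next
  case (add f g)
  show ?case by (rule trig_on_circle.add[OF add.IH]) simp
next
  case (mult f g)
  then show ?case using trig_mult by simp
qed

lemma trig_polynomial_function:
  fixes p :: "complex \<Rightarrow> complex"
  assumes "polynomial_function p"
  shows "trig_on_circle p"
proof -
  have "real_polynomial_function (Re \<circ> p)" "real_polynomial_function (Im \<circ> p)"
    using assms bounded_linear_Re bounded_linear_Im by (auto simp: polynomial_function_def)
  from this[THEN trig_real_polynomial]
  have re: "trig_on_circle (\<lambda>z. of_real (Re (p z)))" and im: "trig_on_circle (\<lambda>z. of_real (Im (p z)))"
    by simp_all
  have "trig_on_circle (\<lambda>z. \<i> * of_real (Im (p z)))"
    by (rule trig_mult_monom[OF im, of _ \<i> 0]) simp
  from re this show ?thesis
    by (rule trig_on_circle.add) (simp flip: complex_eq)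
qed

text \<open>
  Uniform approximation by trigonometric polynomials puts the continuous functions into \<open>X\<close>; dominated
  convergence then adds indicators of closed sets, of Borel sets, and finally all of \<open>L\<^sup>2\<close>.
\<close>

lemma trig_polynomials_dense:
  assumes X: "closed X" "subspace X" and sc: "\<And>a f. f \<in> X \<Longrightarrow> scaleC a f \<in> X"
    and mon: "\<And>k. zpow k \<in> X"
  shows "f \<in> X"
proof -
  \<comment> \<open>Phrased with an a.e. equal representative because \<open>h\<close> is arbitrary
    off the circle and need not be measurable, so \<open>abs_l2T h\<close> may be
    meaningless.\<close>
  have trig: "\<exists>p\<in>X. AE z in circle_measure. rep_l2T p z = h z" if "trig_on_circle h" for h
    using that
  proof induction
    case (monom f a k)
    have "AE z in circle_measure. rep_l2T (scaleC a (zpow k)) z = f z"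
      using rep_scaleC_AE[of a "zpow k"] rep_zpow_AE[of k] AE_circle_norm
      by eventually_elim (simp add: monom)
    with sc[OF mon] show ?case by blast
  next
    case (add f g h)
    then obtain p q where pq: "p \<in> X" "q \<in> X" "AE z in circle_measure. rep_l2T p z = f z"
      "AE z in circle_measure. rep_l2T q z = g z" by blast
    have "AE z in circle_measure. rep_l2T (p + q) z = h z"
      using rep_add_AE[of p q] pq(3,4) AE_circle_norm by eventually_elim (simp add: add)
    with pq X(2) show ?case using subspace_add by blast
  qed
  have cont: "square_integrable h \<and> abs_l2T h \<in> X" if h: "continuous_on UNIV h" for h
  proof
    have [measurable]: "h \<in> borel_measurable borel"
      using h by (rule borel_measurable_continuous_onI)
    have hs: "continuous_on (sphere 0 1) h" using h by (rule continuous_on_subset) simp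
    obtain B where B: "\<And>z. z \<in> sphere 0 1 \<Longrightarrow> norm (h z) \<le> B"
      using compact_imp_bounded[OF compact_continuous_image[OF hs compact_sphere]]
      unfolding bounded_iff by (metis imageI)
    have "AE z in circle_measure. norm (h z) \<le> B"
      using AE_circle_norm by eventually_elim (simp add: B)
    then show si: "square_integrable h" by (intro square_integrable_bounded) simp_all
    have "\<exists>p\<in>X. dist p (abs_l2T h) < e" if e: "e > 0" for e
    proof -
      obtain g where g: "polynomial_function g" "\<And>z. z \<in> sphere 0 1 \<Longrightarrow> norm (h z - g z) < e / 2"
        using Stone_Weierstrass_polynomial_function[OF compact_sphere hs, of "e / 2"] e by auto
      obtain p where p: "p \<in> X" "AE z in circle_measure. rep_l2T p z = g z"
        using trig[OF trig_polynomial_function[OF g(1)]] by blast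
      have "AE z in circle_measure. norm (rep_l2T (p - abs_l2T h) z) \<le> e / 2"
        using rep_diff_AE[of p "abs_l2T h"] rep_abs_AE[OF si] p(2) AE_circle_norm
      proof eventually_elim
        fix z assume "rep_l2T (p - abs_l2T h) z = rep_l2T p z - rep_l2T (abs_l2T h) z"
          "rep_l2T (abs_l2T h) z = h z" "rep_l2T p z = g z" "norm z = 1"
        then show "norm (rep_l2T (p - abs_l2T h) z) \<le> e / 2"
          using g(2)[of z] by (simp add: norm_minus_commute)
      qed
      from norm_l2T_le[OF this] e have "dist p (abs_l2T h) < e" by (simp add: dist_norm)
      with p(1) show ?thesis by blast
    qed
    then show "abs_l2T h \<in> X" using X(1) closed_approachable by blast
  qed
  have one: "square_integrable (\<lambda>z. 1)"
    by (rule square_integrable_bounded[where c = 1]) simp_all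
  let ?ind = "\<lambda>A z. indicator A z :: complex"
  have bd: "norm (?ind A z) \<le> norm (1 :: complex)" for A and z :: complex
    by (simp add: indicator_def)
  have si: "square_integrable (?ind A)" if "A \<in> sets borel" for A
    by (rule square_integrable_bounded[where c = 1]) (use that in \<open>simp_all add: indicator_def\<close>)
  have "abs_l2T (?ind F) \<in> X" if F: "closed F" for F
  \<comment> \<open>\<open>infdist\<close> to the empty set is 0 by convention, so the approximation
    below would converge to 1 instead of 0.\<close>
  proof (cases "F = {}")
    case True
    then show ?thesis using X(2) subspace_0 by (simp flip: zero_l2T.abs_eq)
  next
    case False
    \<comment> \<open>Continuous functions with values in [0,1] that equal 1 on \<open>F\<close> and
      are eventually 0 at each point outside it.\<close>
    define s where "s = (\<lambda>(i::nat) z. complex_of_real (max 0 (1 - real i * infdist z F)))"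
    have s: "continuous_on UNIV (s i)" for i
      unfolding s_def by (intro continuous_intros)
    have "(\<lambda>i. abs_l2T (s i)) \<longlonglongrightarrow> abs_l2T (?ind F)"
    proof (rule abs_l2T_tendsto(3)[OF _ _ one])
      show "s i \<in> borel_measurable borel" for i
        using s by (rule borel_measurable_continuous_onI)
      show "?ind F \<in> borel_measurable borel" using F by simp
      show "norm (s i z) \<le> norm (1 :: complex)" for i z
        by (simp add: s_def infdist_nonneg)
      show "(\<lambda>i. s i z) \<longlonglongrightarrow> ?ind F z" for z
      proof (cases "z \<in> F")
        case True
        then show ?thesis by (simp add: s_def)
      next
        case out: False
        have d: "infdist z F > 0"
          using infdist_pos_not_in_closed[OF F False out] .
        obtain N where N: "real N * infdist z F > 1"
          using reals_Archimedean3[OF d] by blast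
        have "\<forall>\<^sub>F i in sequentially. s i z = 0"
          using eventually_ge_at_top[of N]
        proof eventually_elim
          fix i assume "N \<le> i"
          then have "real N * infdist z F \<le> real i * infdist z F"
            using d by (intro mult_right_mono) simp_all
          with N show "s i z = 0" by (simp add: s_def)
        qed
        then show ?thesis using out by (simp add: tendsto_eventually)
      qed
    qed
    then show ?thesis
      by (rule closed_sequentially[OF X(1), rotated]) (use cont[OF s] in blast)
  qed
  note closed_ind = this
  have borel_ind: "abs_l2T (?ind A) \<in> X" if A: "A \<in> sets borel" for A
  proof -
    \<comment> \<open>Closed sets form an intersection-stable generator, so Dynkin's induction needs
      only complements and countable disjoint unions, which match the linear structure and the
      closedness of \<open>X\<close>.\<close>
    have eq: "sigma_sets UNIV (Collect closed) = sets (borel :: complex measure)"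
      unfolding borel_eq_closed by (rule sets_measure_of[symmetric]) simp
    have cl: "Collect closed \<subseteq> Pow (UNIV :: complex set)" by simp
    have st: "Int_stable (Collect closed :: complex set set)"
      by (auto simp: Int_stable_def)
    have "A \<in> sigma_sets UNIV (Collect closed)" using A eq by simp
    from st cl this show ?thesis
    proof (induction rule: sigma_sets_induct_disjoint)
      case (basic A)
      then show ?case using closed_ind by simp
    next
      case empty
      show ?case using closed_ind[of "{}"] by simp
    next
      case (compl A)
      then have A: "A \<in> sets borel" by (simp add: eq)
      have "?ind (UNIV - A) = (\<lambda>z. ?ind UNIV z + (- 1) * ?ind A z)"
        by (auto simp: fun_eq_iff indicator_def)
      then have "abs_l2T (?ind (UNIV - A)) = abs_l2T (?ind UNIV) - abs_l2T (?ind A)"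
        unfolding minus_l2T_def
        using abs_l2T_add[OF si[of UNIV] square_integrable_scale[OF si[OF A], of "- 1"]]
          abs_l2T_scale[OF si[OF A], of "- 1"] by simp
      then show ?case using compl closed_ind[of UNIV] X(2) subspace_diff by simp
    next
      case (union A)
      then have A [measurable]: "A i \<in> sets borel" for i by (auto simp: eq)
      have part: "abs_l2T (?ind (\<Union>i<m. A i)) \<in> X" for m :: nat
      proof (induction m)
        case 0
        show ?case using closed_ind[of "{}"] by simp
      next
        case (Suc m)
        have "(\<Union>i<m. A i) \<inter> A m = {}"
          using disjoint_family_onD[OF union(1), of _ m] by (fastforce dest: less_imp_neq)
        then have "?ind (\<Union>i<Suc m. A i) = (\<lambda>z. ?ind (\<Union>i<m. A i) z + ?ind (A m) z)"
          by (intro ext) (auto simp: indicator_def lessThan_Suc)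
        moreover have "square_integrable (?ind (\<Union>i<m. A i))" "square_integrable (?ind (A m))"
          by (rule si; simp)+
        ultimately have "abs_l2T (?ind (\<Union>i<Suc m. A i)) = abs_l2T (?ind (\<Union>i<m. A i)) + abs_l2T (?ind (A m))"
          using abs_l2T_add by simp
        then show ?case using subspace_add[OF X(2) Suc.IH union(3)[of m]] by simp
      qed
      have "(\<lambda>m. abs_l2T (?ind (\<Union>i<m. A i))) \<longlonglongrightarrow> abs_l2T (?ind (\<Union>i. A i))"
      proof (rule abs_l2T_tendsto(3)[OF _ _ one bd])
        show "(\<lambda>m. ?ind (\<Union>i<m. A i) z) \<longlonglongrightarrow> ?ind (\<Union>i. A i) z" for z
          by (rule LIMSEQ_indicator_UN)
      qed simp_all
      then show ?case by (rule closed_sequentially[OF X(1), rotated]) (rule part)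
    qed
  qed
  \<comment> \<open>\<open>S\<close> is an arbitrary finite set to allow induction; with
    \<open>S\<close> the range of a simple function, the sum over its level sets is that
    function.\<close>
  have simple: "square_integrable (\<lambda>z. \<Sum>y\<in>S. y * ?ind (h -` {y}) z)
      \<and> abs_l2T (\<lambda>z. \<Sum>y\<in>S. y * ?ind (h -` {y}) z) \<in> X"
    if [measurable]: "h \<in> borel_measurable borel" and S: "finite S" for h and S
    using S
  proof induction
    case empty
    show ?case using X(2) subspace_0 by (simp add: square_integrable_zero flip: zero_l2T.abs_eq)
  next
    case (insert y S)
    have A: "h -` {y} \<in> sets borel" using measurable_sets[OF that(1), of "{y}"] by simp
    have 1: "square_integrable (\<lambda>z. y * ?ind (h -` {y}) z)"
      by (rule square_integrable_scale[OF si[OF A]])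
    have "abs_l2T (\<lambda>z. y * ?ind (h -` {y}) z) = scaleC y (abs_l2T (?ind (h -` {y})))"
      by (rule abs_l2T_scale[OF si[OF A]])
    moreover have "scaleC y (abs_l2T (?ind (h -` {y}))) \<in> X"
      by (rule sc[OF borel_ind[OF A]])
    ultimately have "abs_l2T (\<lambda>z. y * ?ind (h -` {y}) z) \<in> X" by simp
    from subspace_add[OF X(2) this conjunct2[OF insert.IH]] square_integrable_add[OF 1 conjunct1[OF insert.IH]]
    show ?case
      unfolding sum.insert[OF insert.hyps(1,2)] abs_l2T_add[OF 1 conjunct1[OF insert.IH]] by blast
  qed
  \<comment> \<open>The base point 0 turns the distance estimate of the approximation theorem into
    domination by twice the modulus of the representative.\<close>
  obtain s where s: "\<And>i. simple_function borel (s i)"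
    "\<And>z. (\<lambda>i. s i z) \<longlonglongrightarrow> rep_l2T f z" "\<And>i z. norm (s i z) \<le> 2 * norm (rep_l2T f z)"
    using borel_measurable_implies_sequence_metric[OF rep_borel_measurable[of f], of 0] by auto
  have sX: "abs_l2T (s i) \<in> X" for i
  proof -
    have fin: "finite (range (s i))" using s(1)[of i] by (simp add: simple_function_def)
    have m: "s i \<in> borel_measurable borel" using s(1) by (rule borel_measurable_simple_function)
    have "(\<lambda>z. \<Sum>y\<in>range (s i). y * ?ind (s i -` {y}) z) = s i"
    proof
      fix z
      have "(\<Sum>y\<in>range (s i). y * ?ind (s i -` {y}) z) = (\<Sum>y\<in>range (s i). if y = s i z then y else 0)"
        by (intro sum.cong) (auto simp: indicator_def)
      then show "(\<Sum>y\<in>range (s i). y * ?ind (s i -` {y}) z) = s i z" using fin by simp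
    qed
    then show ?thesis using simple[OF m fin] by simp
  qed
  have "(\<lambda>i. abs_l2T (s i)) \<longlonglongrightarrow> abs_l2T (rep_l2T f)"
  proof (rule abs_l2T_tendsto(3)[OF _ _ square_integrable_scale[OF square_integrable_rep[of f], of 2]])
    show "s i \<in> borel_measurable borel" for i using s(1) by (rule borel_measurable_simple_function)
  qed (use s in \<open>simp_all add: norm_mult\<close>)
  from closed_sequentially[OF X(1) sX this] show ?thesis by simp
qed

section \<open>Convergence of Fourier series\<close>

lemma fourier_coeff_add: "fourier_coeff (f + g) k = fourier_coeff f k + fourier_coeff g k"
  by (simp add: fourier_coeff_def cinner_add_left)

lemma fourier_coeff_diff: "fourier_coeff (f - g) k = fourier_coeff f k - fourier_coeff g k"
  by (simp add: fourier_coeff_def cinner_diff_left)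

lemma fourier_coeff_scaleC: "fourier_coeff (scaleC a f) k = a * fourier_coeff f k"
  by (simp add: fourier_coeff_def cinner_scaleC_left)

lemma fourier_coeff_zpow: "fourier_coeff (zpow j) k = (if j = k then 1 else 0)"
  by (simp add: fourier_coeff_def zpow_orthonormal)

definition fourier_sum :: "int set \<Rightarrow> l2T \<Rightarrow> l2T" where
  "fourier_sum F f = (\<Sum>k\<in>F. scaleC (fourier_coeff f k) (zpow k))"

lemma scaleC_sum: "scaleC a (sum f A) = (\<Sum>x\<in>A. scaleC a (f x))"
  by (induction A rule: infinite_finite_induct) (simp_all add: scaleC_add_right)

lemma fourier_sum_add: "fourier_sum F (f + g) = fourier_sum F f + fourier_sum F g"
  by (simp add: fourier_sum_def fourier_coeff_add scaleC_add_left sum.distrib)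

lemma fourier_sum_scaleC: "fourier_sum F (scaleC a f) = scaleC a (fourier_sum F f)"
  by (simp add: fourier_sum_def fourier_coeff_scaleC scaleC_sum scaleC_scaleC)

lemma fourier_sum_diff: "fourier_sum F (f - g) = fourier_sum F f - fourier_sum F g"
  by (simp add: minus_l2T_def fourier_sum_add fourier_sum_scaleC)

text \<open>Bessel's inequality: the partial sum is orthogonal to the remainder, and Cauchy-Schwarz
  applies to its inner product with \<open>f\<close>.\<close>

lemma norm_fourier_sum_le:
  assumes "finite F"
  shows "norm (fourier_sum F f) \<le> norm f"
proof -
  have fc: "fourier_coeff (fourier_sum F f) k = fourier_coeff f k" if "k \<in> F" for k
  proof -
    have "fourier_coeff (fourier_sum F f) k = (\<Sum>j\<in>F. if j = k then fourier_coeff f j else 0)"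
      unfolding fourier_sum_def fourier_coeff_def[of "sum _ _"] cinner_sum_left
      by (intro sum.cong) (simp_all add: cinner_scaleC_left zpow_orthonormal)
    with that assms show ?thesis by simp
  qed
  have "cinner (f - fourier_sum F f) (fourier_sum F f) = 0"
    by (subst (2) fourier_sum_def, unfold cinner_sum_right, rule sum.neutral)
      (simp add: cinner_scaleC_right fc fourier_coeff_diff flip: fourier_coeff_def)
  then have "inner (fourier_sum F f) (fourier_sum F f) = inner f (fourier_sum F f)"
    by (simp add: inner_l2T_def cinner_diff_left)
  then have "norm (fourier_sum F f) * norm (fourier_sum F f) \<le> norm f * norm (fourier_sum F f)"
    using norm_cauchy_schwarz[of f "fourier_sum F f"]
    unfolding power2_eq_square[symmetric] power2_norm_eq_inner by simp
  then show ?thesis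
    by (cases "norm (fourier_sum F f) = 0") (simp_all add: mult_le_cancel_right)
qed

lemma tendsto_scaleC:
  assumes "(h \<longlongrightarrow> f) F"
  shows "((\<lambda>x. scaleC a (h x)) \<longlongrightarrow> scaleC a f) F"
proof -
  have "bounded_linear (scaleC a)"
    by (rule bounded_linear_intro[where K = "norm a"])
      (simp_all add: scaleC_add_right scaleC_scaleR norm_scaleC mult.commute)
  then show ?thesis using assms bounded_linear.tendsto by blast
qed

text \<open>The functions whose Fourier series converges to them form a subspace \<open>X\<close>
  containing all \<open>zpow k\<close>. It is closed because partial sums are contractions, by an
  e/3 argument, so density makes it everything.\<close>

lemma fourier_series_has_sum:
  "((\<lambda>k. scaleC (fourier_coeff f k) (zpow k)) has_sum f) UNIV"
proof -
  define X where "X = {f. ((\<lambda>F. fourier_sum F f) \<longlongrightarrow> f) (finite_subsets_at_top UNIV)}"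
  have "f \<in> X"
  proof (rule trig_polynomials_dense)
    show "subspace X"
      unfolding subspace_def X_def
      by (auto simp: fourier_sum_add scaleR_eq_scaleC fourier_sum_scaleC intro!: tendsto_add tendsto_scaleC)
        (simp add: fourier_sum_def fourier_coeff_def)
    show "scaleC a g \<in> X" if "g \<in> X" for a g
      using that by (simp add: X_def fourier_sum_scaleC tendsto_scaleC)
    show "zpow k \<in> X" for k
    proof -
      have "\<forall>\<^sub>F F in finite_subsets_at_top UNIV. finite F \<and> {k} \<subseteq> F \<and> F \<subseteq> UNIV"
        unfolding eventually_finite_subsets_at_top by (intro exI[of _ "{k}"]) simp
      then have "\<forall>\<^sub>F F in finite_subsets_at_top UNIV. fourier_sum F (zpow k) = zpow k"
      proof eventually_elim
        fix F :: "int set" assume F: "finite F \<and> {k} \<subseteq> F \<and> F \<subseteq> UNIV"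
        have "fourier_sum F (zpow k) = (\<Sum>j\<in>F. if j = k then zpow j else 0)"
          unfolding fourier_sum_def by (intro sum.cong) (auto simp: fourier_coeff_zpow)
        with F show "fourier_sum F (zpow k) = zpow k" by simp
      qed
      then show ?thesis by (simp add: X_def tendsto_eventually)
    qed
    show "closed X"
      unfolding closure_subset_eq[symmetric]
    proof
      fix f assume "f \<in> closure X"
      then have approx: "\<forall>e>0. \<exists>g\<in>X. dist g f < e" by (simp add: closure_approachable)
      have "((\<lambda>F. fourier_sum F f) \<longlongrightarrow> f) (finite_subsets_at_top UNIV)"
      proof (rule tendstoI)
        fix e :: real assume "e > 0"
        then obtain g where g: "g \<in> X" "dist g f < e / 3"
          using approx by (meson divide_pos_pos zero_less_numeral)
        have "\<forall>\<^sub>F F in finite_subsets_at_top UNIV. dist (fourier_sum F g) g < e / 3"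
          by (rule tendstoD) (use g(1) \<open>e > 0\<close> in \<open>simp_all add: X_def\<close>)
        moreover have "\<forall>\<^sub>F F in finite_subsets_at_top (UNIV :: int set). finite F"
          by (auto simp: eventually_finite_subsets_at_top)
        ultimately show "\<forall>\<^sub>F F in finite_subsets_at_top UNIV. dist (fourier_sum F f) f < e"
        proof eventually_elim
          fix F :: "int set" assume F: "dist (fourier_sum F g) g < e / 3" "finite F"
          have "dist (fourier_sum F f) (fourier_sum F g) \<le> dist f g"
            using norm_fourier_sum_le[OF F(2), of "f - g"] by (simp add: dist_norm fourier_sum_diff)
          then show "dist (fourier_sum F f) f < e"
            using F(1) g(2) dist_triangle[of "fourier_sum F f" f "fourier_sum F g"]
              dist_triangle[of "fourier_sum F g" f g] by (simp add: dist_commute)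
        qed
      qed
      then show "f \<in> X" by (simp add: X_def)
    qed
  qed
  then show ?thesis
    by (simp add: X_def has_sum_def fourier_sum_def[abs_def])
qed

lemma fourier_coeff_eqI:
  assumes "\<And>k. fourier_coeff f k = fourier_coeff g k"
  shows "f = g"
  using fourier_series_has_sum[of f] fourier_series_has_sum[of g]
  by (simp add: assms has_sum_unique)

section \<open>Splitting a function by residues of the exponents\<close>

text \<open>The terms are the powers of a root of unity \<open>?w\<close> with
  \<open>?w ^ n = 1\<close>. Either \<open>?w\<close> is 1, which happens exactly when n divides m,
  or the geometric sum vanishes.\<close>

lemma roots_of_unity_sum:
  fixes m :: int
  assumes "n > 0"
  shows "(\<Sum>j<n. cis (2 * pi / n) powi (int j * m)) = (if int n dvd m then of_nat n else 0)"
proof -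
  let ?w = "cis (2 * pi * m / n)"
  have eq: "cis (2 * pi / n) powi (int j * m) = ?w ^ j" for j :: nat
    by (simp add: cis_power_int Complex.DeMoivre mult_ac)
  have one: "?w ^ n = 1"
    using assms by (simp add: Complex.DeMoivre cis_multiple_2pi)
  have iff: "?w = 1 \<longleftrightarrow> int n dvd m"
  proof
    assume "?w = 1"
    then have "cos (2 * pi * m / n) = 1" by (simp add: complex_eq_iff)
    then obtain l :: int where l: "2 * pi * m / n = of_int l * 2 * pi"
      using cos_one_2pi_int by blast
    then have "real_of_int m = real_of_int (l * int n)" using assms by (simp add: field_simps)
    then have "m = l * int n" by linarith
    then show "int n dvd m" by simp
  next
    assume "int n dvd m"
    then obtain l where "m = int n * l" ..
    then have "2 * pi * m / n = 2 * pi * l" using assms by simp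
    then show "?w = 1" by (simp only: cis_multiple_2pi Ints_of_int)
  qed
  show ?thesis
  proof (cases "int n dvd m")
    case True
    with iff show ?thesis by (simp add: eq)
  next
    case False
    with iff have "?w \<noteq> 1" by simp
    then have "(\<Sum>j<n. ?w ^ j) = 0" by (simp add: geometric_sum one)
    with False show ?thesis by (simp add: eq)
  qed
qed

text \<open>The witness is \<open>f\<close> composed with rotation by \<open>w\<close>; rotation
  invariance of the measure moves the factor \<open>w powi k\<close> out of the integral.\<close>

lemma rotated_coeffs_exist:
  fixes w :: complex
  assumes "norm w = 1"
  shows "\<exists>h. \<forall>k. fourier_coeff h k = w powi k * fourier_coeff f k"
proof -
  let ?g = "\<lambda>z. rep_l2T f (w * z)"
  have "integrable (distr circle_measure borel ((*) w)) (\<lambda>z. (norm (rep_l2T f z))\<^sup>2)"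
    using square_integrable_rep[of f] by (simp add: square_integrable_def circle_measure_rotate[OF assms])
  then have "integrable circle_measure (\<lambda>z. (norm (?g z))\<^sup>2)"
    by (subst (asm) integrable_distr_eq) simp_all
  then have si: "square_integrable ?g" by (simp add: square_integrable_def)
  have "fourier_coeff (abs_l2T ?g) k = w powi k * fourier_coeff f k" for k
  proof -
    have [measurable]: "(\<lambda>z::complex. z powi k) \<in> borel_measurable borel"
      by (rule power_int_measurable)
    have "fourier_coeff f k = (\<integral>z. rep_l2T f z * cnj (z powi k) \<partial>circle_measure)"
      unfolding fourier_coeff_def cinner_rep
    proof (rule integral_cong_AE)
      show "AE z in circle_measure. rep_l2T f z * cnj (rep_l2T (zpow k) z) = rep_l2T f z * cnj (z powi k)"
        using rep_zpow_AE[of k] by eventually_elim simp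
    qed simp_all
    also have "\<dots> = (\<integral>z. ?g z * cnj ((w * z) powi k) \<partial>circle_measure)"
      by (rule integral_rotate[OF assms, symmetric]) simp
    also have "\<dots> = (\<integral>z. cnj (w powi k) * (?g z * cnj (z powi k)) \<partial>circle_measure)"
      by (simp add: power_int_mult_distrib mult_ac)
    also have "\<dots> = cnj (w powi k) * (\<integral>z. ?g z * cnj (z powi k) \<partial>circle_measure)"
      by (rule integral_mult_right_zero)
    also have "(\<integral>z. ?g z * cnj (z powi k) \<partial>circle_measure) = fourier_coeff (abs_l2T ?g) k"
      unfolding fourier_coeff_def cinner_rep
    proof (rule integral_cong_AE)
      show "AE z in circle_measure. ?g z * cnj (z powi k) = rep_l2T (abs_l2T ?g) z * cnj (rep_l2T (zpow k) z)"
        using rep_zpow_AE[of k] rep_abs_AE[OF si] by eventually_elim simp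
    qed simp_all
    finally have "w powi k * fourier_coeff f k = (w powi k * cnj (w powi k)) * fourier_coeff (abs_l2T ?g) k"
      by (simp only: mult.assoc)
    moreover have "w powi k * cnj (w powi k) = 1"
      by (subst complex_norm_square[symmetric]) (simp add: norm_power_int assms)
    ultimately show ?thesis by (simp only: mult_1_left)
  qed
  then show ?thesis by blast
qed

text \<open>The roots-of-unity filter: a weighted average of the n rotates of \<open>f\<close> keeps
  exactly the exponents in one residue class.\<close>

lemma component_coeffs_exist:
  assumes "n > 0"
  shows "\<exists>h. \<forall>k. fourier_coeff h k = (if int n dvd k - r then fourier_coeff f k else 0)"
proof -
  let ?w = "cis (2 * pi / n)"
  have "\<exists>h. \<forall>k. fourier_coeff h k = (?w powi j) powi k * fourier_coeff f k" for j
    using rotated_coeffs_exist[of "?w powi j" f] by (auto simp: norm_power_int)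
  then obtain H where H: "\<And>j k. fourier_coeff (H j) k = (?w powi j) powi k * fourier_coeff f k"
    by metis
  \<comment> \<open>The weight shifts the class of r to that of 0: the k-th coefficient acquires the
    sum of \<open>?w powi (int j * (k - r))\<close>, which is n or 0.\<close>
  define h where "h = scaleC (1 / of_nat n) (\<Sum>j<n. scaleC (?w powi (- (int j * r))) (H (int j)))"
  have "fourier_coeff h k = (if int n dvd k - r then fourier_coeff f k else 0)" for k
  proof -
    have "fourier_coeff h k
        = (1 / of_nat n) * (\<Sum>j<n. ?w powi (- (int j * r)) * fourier_coeff (H (int j)) k)"
      by (simp add: h_def fourier_coeff_def cinner_scaleC_left cinner_sum_left)
    also have "(\<Sum>j<n. ?w powi (- (int j * r)) * fourier_coeff (H (int j)) k)
        = (\<Sum>j<n. ?w powi (int j * (k - r))) * fourier_coeff f k"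
      unfolding sum_distrib_right
    proof (rule sum.cong)
      fix j
      have "?w powi (- (int j * r)) * (?w powi int j) powi k = ?w powi (int j * (k - r))"
        by (subst power_int_mult[symmetric], subst power_int_add[symmetric])
          (simp_all add: algebra_simps)
      then show "?w powi (- (int j * r)) * fourier_coeff (H (int j)) k
          = ?w powi (int j * (k - r)) * fourier_coeff f k"
        by (simp add: H mult.assoc[symmetric])
    qed simp
    finally show ?thesis using assms by (simp add: roots_of_unity_sum)
  qed
  then show ?thesis by blast
qed

text \<open>The Fourier series of \<open>f\<close> has zero terms off the progression, and the rest
  is reindexed along an injection.\<close>

lemma arith_progression_has_sum:
  assumes "n > 0" and "\<And>k. \<not> int n dvd k - r \<Longrightarrow> fourier_coeff f k = 0"
  shows "((\<lambda>k. scaleC (fourier_coeff f (int n * k + r)) (zpow (int n * k + r))) has_sum f) UNIV"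
proof -
  let ?F = "\<lambda>k. scaleC (fourier_coeff f k) (zpow k)"
  have inj: "inj (\<lambda>k. int n * k + r)" using assms(1) by (auto simp: inj_def)
  have "(?F has_sum f) (range (\<lambda>k. int n * k + r)) \<longleftrightarrow> (?F has_sum f) UNIV"
  proof (rule has_sum_cong_neutral)
    fix k assume "k \<in> UNIV - range (\<lambda>k. int n * k + r)"
    then have "\<not> int n dvd k - r" by (auto simp: dvd_def image_iff algebra_simps)
    then show "?F k = 0" using assms(2) by simp
  qed auto
  then have "(?F has_sum f) (range (\<lambda>k. int n * k + r))"
    using fourier_series_has_sum by blast
  then show ?thesis
    by (subst (asm) has_sum_reindex[OF inj]) (simp add: o_def)
qed

text \<open>\<open>component\<close> is an infinite sum, which would default to 0 without
  convergence. The filtered function \<open>h\<close> shows that it converges and identifies its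
  value.\<close>

lemma fourier_coeff_component:
  assumes "n > 0"
  shows "fourier_coeff (component n i f) k
    = (if int n dvd k - (int i - 1) then fourier_coeff f k else 0)"
proof -
  obtain h where h: "\<And>k. fourier_coeff h k = (if int n dvd k - (int i - 1) then fourier_coeff f k else 0)"
    using component_coeffs_exist[OF assms] by blast
  have "((\<lambda>k. scaleC (fourier_coeff h (int n * k + (int i - 1))) (zpow (int n * k + (int i - 1)))) has_sum h) UNIV"
    by (rule arith_progression_has_sum[OF assms]) (simp add: h)
  then have "((\<lambda>k. scaleC (fourier_coeff f (int n * k + int i - 1)) (zpow (int n * k + int i - 1))) has_sum h) UNIV"
    by (simp add: h add_diff_eq)
  then have "component n i f = h"
    unfolding component_def by (rule infsumI)
  with h show ?thesis by simp
qed

lemma component_sum: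
  assumes "n > 0"
  shows "(\<Sum>i=1..n. component n i f) = f"
proof (rule fourier_coeff_eqI)
  fix k
  \<comment> \<open>Residues start at 0 and components at 1; \<open>i0\<close> is the only component
    that sees the exponent k.\<close>
  define i0 where "i0 = nat (k mod int n) + 1"
  have i0: "i0 \<in> {1..n}" using assms by (simp add: i0_def Suc_leI nat_less_iff)
  have iff: "int n dvd k - (int i - 1) \<longleftrightarrow> i = i0" if "i \<in> {1..n}" for i
  proof -
    have "int n dvd k - (int i - 1) \<longleftrightarrow> k mod int n = (int i - 1) mod int n"
      by (simp add: mod_eq_dvd_iff)
    also have "(int i - 1) mod int n = int i - 1" using that by simp
    finally show ?thesis using that assms by (auto simp: i0_def)
  qed
  have "fourier_coeff (\<Sum>i=1..n. component n i f) k = (\<Sum>i=1..n. fourier_coeff (component n i f) k)"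
    by (simp add: fourier_coeff_def cinner_sum_left)
  also have "\<dots> = (\<Sum>i=1..n. if i = i0 then fourier_coeff f k else 0)"
    by (rule sum.cong) (simp_all add: fourier_coeff_component[OF assms] iff)
  also have "\<dots> = fourier_coeff f k" using i0 by simp
  finally show "fourier_coeff (\<Sum>i=1..n. component n i f) k = fourier_coeff f k" .
qed

section \<open>Isometries commuting with a power of the shift\<close>

lemma Jstar_add: "Jstar (f + g) = Jstar f + Jstar g"
  by transfer (simp add: ae_equal_def square_integrable_add square_integrable_cnj_cnj)

lemma Jstar_scaleC: "Jstar (scaleC a f) = scaleC (cnj a) (Jstar f)"
  by transfer (simp add: ae_equal_def square_integrable_scale square_integrable_cnj_cnj)

lemma Jstar_Jstar [simp]: "Jstar (Jstar f) = f"
  by transfer (simp add: ae_equal_def)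

lemma Jstar_zpow [simp]: "Jstar (zpow k) = zpow k"
  by transfer (simp add: ae_equal_def square_integrable_powi)

text \<open>Conjugating the values exchanges the arguments, and the substitution of
  \<open>cnj z\<close> for z preserves the measure.\<close>

lemma cinner_Jstar: "cinner (Jstar f) (Jstar g) = cinner g f"
proof -
  have "cinner (Jstar f) (Jstar g)
      = (\<integral>z. rep_l2T g (cnj z) * cnj (rep_l2T f (cnj z)) \<partial>circle_measure)"
    unfolding cinner_rep
  proof (rule integral_cong_AE)
    show "AE z in circle_measure. rep_l2T (Jstar f) z * cnj (rep_l2T (Jstar g) z)
        = rep_l2T g (cnj z) * cnj (rep_l2T f (cnj z))"
      using rep_Jstar_AE[of f] rep_Jstar_AE[of g] by eventually_elim simp
  qed simp_all
  also have "\<dots> = (\<integral>z. rep_l2T g z * cnj (rep_l2T f z) \<partial>distr circle_measure borel cnj)"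
    by (rule integral_distr[symmetric]) simp_all
  finally show ?thesis by (simp add: circle_measure_cnj cinner_rep)
qed

lemma powi_add_circle: "norm z = 1 \<Longrightarrow> z powi (j + k) = z powi j * z powi k" for z :: complex
  by (rule power_int_add) auto

lemma mult_zpow_zpow: "mult_op (zpow j) (zpow k) = zpow (j + k)"
proof (rule mult_op_eqI)
  show "AE z in circle_measure. rep_l2T (zpow (j + k)) z = rep_l2T (zpow j) z * rep_l2T (zpow k) z"
    using rep_zpow_AE[of j] rep_zpow_AE[of k] rep_zpow_AE[of "j + k"] AE_circle_norm
    by eventually_elim (simp add: powi_add_circle)
qed

lemma mult_zpow_mult_zpow: "mult_op (zpow j) (mult_op (zpow k) f) = mult_op (zpow (j + k)) f"
proof (rule l2T_eqI)
  show "AE z in circle_measure.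
      rep_l2T (mult_op (zpow j) (mult_op (zpow k) f)) z = rep_l2T (mult_op (zpow (j + k)) f) z"
    using rep_mult_zpow_AE[of j "mult_op (zpow k) f"] rep_mult_zpow_AE[of k f]
      rep_mult_zpow_AE[of "j + k" f] AE_circle_norm
    by eventually_elim (simp add: powi_add_circle)
qed

lemma mult_zpow_0 [simp]: "mult_op (zpow 0) f = f"
proof (rule l2T_eqI)
  show "AE z in circle_measure. rep_l2T (mult_op (zpow 0) f) z = rep_l2T f z"
    using rep_mult_zpow_AE[of 0 f] by eventually_elim simp
qed

lemma ess_bounded_iff: "ess_bounded f \<longleftrightarrow> (\<exists>c. AE z in circle_measure. norm (rep_l2T f z) \<le> c)"
  by (rule ess_bounded.rep_eq)

lemma ess_bounded_mult_zpow:
  assumes "ess_bounded f"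
  shows "ess_bounded (mult_op (zpow k) f)"
proof -
  obtain c where c: "AE z in circle_measure. norm (rep_l2T f z) \<le> c"
    using assms by (auto simp: ess_bounded_iff)
  have "AE z in circle_measure. norm (rep_l2T (mult_op (zpow k) f) z) \<le> c"
    using c rep_mult_zpow_AE[of k f] AE_circle_norm
    by eventually_elim (simp add: norm_mult norm_power_int)
  then show ?thesis by (auto simp: ess_bounded_iff)
qed

lemma integrable_rep_mult: "integrable circle_measure (\<lambda>z. rep_l2T f z * rep_l2T g z)"
proof -
  have "square_integrable (\<lambda>z. cnj (rep_l2T g z))"
    using square_integrable_rep[of g] by (simp add: square_integrable_def)
  from square_integrable_mult_cnj[OF square_integrable_rep[of f] this] show ?thesis by simp
qed

lemma norm_zpow: "norm (zpow k) = 1"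
  by (simp add: norm_l2T_def inner_l2T_def zpow_orthonormal)

text \<open>
  Multiplication by \<open>\<xi>\<close> is unbounded on \<open>L\<^sup>2\<close> in general, but it is continuous from \<open>L\<^sup>2\<close> to \<open>L\<^sup>1\<close>,
  so an operator that agrees with it on the terms of a series agrees with it on the sum.
\<close>

lemma multiplication_on_has_sum:
  assumes U: "bounded_linear U" and sum: "(h has_sum f) A"
    and each: "\<And>k. AE z in circle_measure. rep_l2T (U (h k)) z = rep_l2T \<xi> z * rep_l2T (h k) z"
  shows "AE z in circle_measure. rep_l2T (U f) z = rep_l2T \<xi> z * rep_l2T f z"
proof -
  interpret U: bounded_linear U by fact
  obtain K where K: "K > 0" "\<And>x. norm (U x) \<le> norm x * K" using U.pos_bounded by blast
  let ?d = "\<lambda>z. rep_l2T (U f) z - rep_l2T \<xi> z * rep_l2T f z"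
  have part: "AE z in circle_measure. rep_l2T (U (sum h F)) z = rep_l2T \<xi> z * rep_l2T (sum h F) z"
    if "finite F" for F
    using that
  proof induction
    case empty
    show ?case using rep_zero_AE by (auto simp: U.zero)
  next
    case (insert k F)
    show ?case
      using rep_add_AE[of "U (h k)" "U (sum h F)"] rep_add_AE[of "h k" "sum h F"] each[of k] insert.IH
      by eventually_elim (simp add: insert.hyps U.add distrib_left)
  qed
  \<comment> \<open>\<open>zpow 0\<close> is a.e. the constant 1 and has norm 1. As a second factor
    it yields integrability here and the comparison of the two norms in \<open>L1\<close>.\<close>
  have int1: "integrable circle_measure (\<lambda>z. rep_l2T p z)" for p
  proof -
    have "AE z in circle_measure. rep_l2T p z * rep_l2T (zpow 0) z = rep_l2T p z"
      using rep_zpow_AE[of 0] by eventually_elim simp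
    then have "integrable circle_measure (\<lambda>z. rep_l2T p z * rep_l2T (zpow 0) z)
        \<longleftrightarrow> integrable circle_measure (\<lambda>z. rep_l2T p z)"
      by (intro integrable_cong_AE) simp_all
    then show ?thesis using integrable_rep_mult by blast
  qed
  have L1: "(\<integral>z. norm (rep_l2T p z) \<partial>circle_measure) \<le> norm p" for p
  proof -
    have "(\<integral>z. norm (rep_l2T p z) \<partial>circle_measure)
        = (\<integral>z. norm (rep_l2T p z * rep_l2T (zpow 0) z) \<partial>circle_measure)"
    proof (rule integral_cong_AE)
      show "AE z in circle_measure. norm (rep_l2T p z) = norm (rep_l2T p z * rep_l2T (zpow 0) z)"
        using rep_zpow_AE[of 0] by eventually_elim simp
    qed simp_all
    then show ?thesis using integral_norm_mult_le[of p "zpow 0"] by (simp add: norm_zpow)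
  qed
  have "(\<integral>z. norm (?d z) \<partial>circle_measure) \<le> (K + norm \<xi>) * e" if e: "e > 0" for e
  proof -
    have "\<forall>\<^sub>F F in finite_subsets_at_top A. dist (sum h F) f < e"
      using sum e unfolding has_sum_def by (rule tendstoD)
    then obtain F where F: "finite F" "dist (sum h F) f < e"
      by (auto simp: eventually_finite_subsets_at_top)
    \<comment> \<open>The defect \<open>?d\<close> vanishes a.e. on finite partial sums, so it is
      unchanged when \<open>f\<close> is replaced by the small tail \<open>p\<close>.\<close>
    define p where "p = f - sum h F"
    have p: "norm p \<le> e" using F(2) by (simp add: p_def dist_norm norm_minus_commute)
    have "(\<integral>z. norm (?d z) \<partial>circle_measure)
        = (\<integral>z. norm (rep_l2T (U p) z - rep_l2T \<xi> z * rep_l2T p z) \<partial>circle_measure)"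
    proof (rule integral_cong_AE)
      show "AE z in circle_measure. norm (?d z) = norm (rep_l2T (U p) z - rep_l2T \<xi> z * rep_l2T p z)"
        using part[OF F(1)] rep_diff_AE[of f "sum h F"] rep_diff_AE[of "U f" "U (sum h F)"]
        by eventually_elim (simp add: p_def U.diff right_diff_distrib)
    qed simp_all
    also have "\<dots> \<le> (\<integral>z. norm (rep_l2T (U p) z) + norm (rep_l2T \<xi> z * rep_l2T p z) \<partial>circle_measure)"
      by (rule integral_mono)
        (use int1 integrable_rep_mult norm_triangle_ineq4 in \<open>auto intro!: integrable_norm Bochner_Integration.integrable_diff Bochner_Integration.integrable_add\<close>)
    also have "\<dots> = (\<integral>z. norm (rep_l2T (U p) z) \<partial>circle_measure)
        + (\<integral>z. norm (rep_l2T \<xi> z * rep_l2T p z) \<partial>circle_measure)"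
      by (rule Bochner_Integration.integral_add) (rule integrable_norm, rule int1 integrable_rep_mult)+
    also have "\<dots> \<le> norm p * K + norm \<xi> * norm p"
      using L1[of "U p"] K(2)[of p] integral_norm_mult_le[of \<xi> p] by linarith
    also have "\<dots> = (K + norm \<xi>) * norm p" by (simp add: algebra_simps)
    also have "\<dots> \<le> (K + norm \<xi>) * e" using p K(1) by (intro mult_left_mono) simp_all
    finally show ?thesis .
  qed
  note small = this
  have "(\<integral>z. norm (?d z) \<partial>circle_measure) \<le> 0 + e" if e: "e > 0" for e
  proof -
    have pos: "K + norm \<xi> > 0" using K(1) by (simp add: add_pos_nonneg)
    then show ?thesis using small[of "e / (K + norm \<xi>)"] e by simp
  qed
  then have "(\<integral>z. norm (?d z) \<partial>circle_measure) \<le> 0" by (rule field_le_epsilon)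
  moreover have "0 \<le> (\<integral>z. norm (?d z) \<partial>circle_measure)" by (rule Bochner_Integration.integral_nonneg) simp
  moreover have "integrable circle_measure (\<lambda>z. norm (?d z))"
    by (intro integrable_norm Bochner_Integration.integrable_diff int1 integrable_rep_mult)
  ultimately have "AE z in circle_measure. norm (?d z) = 0"
    by (subst integral_nonneg_eq_0_iff_AE[symmetric]) simp_all
  then show ?thesis by eventually_elim simp
qed

text \<open>Only invariant sets may be tested, so the square \<open>q\<close> of the modulus is
  first summed over its n rotates. The sum \<open>G\<close> is invariant, has integral n times the
  measure over \<open>E\<close>, and exceeds n there, so \<open>E\<close> is null; \<open>q\<close>
  is one of the summands.\<close>

lemma bounded_if_rotation_invariant_masses:
  fixes n :: nat
  assumes n: "n > 0"
    and mass: "\<And>E. E \<in> sets borel \<Longrightarrow> (\<And>z. cis (2 * pi / n) * z \<in> E \<longleftrightarrow> z \<in> E) \<Longrightarrow>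
      (\<integral>z. indicator E z * (norm (rep_l2T g z))\<^sup>2 \<partial>circle_measure) = measure circle_measure E"
  shows "ess_bounded g"
proof -
  let ?w = "cis (2 * pi / n)"
  interpret finite_measure circle_measure by (rule finite_measure_circle)
  define q where "q = (\<lambda>z. (norm (rep_l2T g z))\<^sup>2)"
  define G where "G z = (\<Sum>j<n. q (?w ^ j * z))" for z
  define E where "E = {z. real n < G z}"
  have [measurable]: "q \<in> borel_measurable borel" unfolding q_def by measurable
  have [measurable]: "G \<in> borel_measurable borel" unfolding G_def by measurable
  have E [measurable]: "E \<in> sets borel" unfolding E_def by measurable
  have intq: "integrable circle_measure q"
    using square_integrable_rep[of g] by (simp add: q_def square_integrable_def)
  have wn: "?w ^ n = 1" using n by (simp add: Complex.DeMoivre)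
  have "G (?w * z) = G z" for z
  proof -
    \<comment> \<open>Adding \<open>q z\<close> completes the cyclic sum: the new last term is again
      \<open>q z\<close>, because \<open>?w ^ n = 1\<close>.\<close>
    have "q z + G (?w * z) = (\<Sum>j<Suc n. q (?w ^ j * z))"
      by (subst sum.lessThan_Suc_shift) (simp add: G_def mult_ac)
    also have "\<dots> = G z + q z" by (simp add: G_def wn)
    finally show ?thesis by simp
  qed
  then have inv: "?w * z \<in> E \<longleftrightarrow> z \<in> E" for z by (simp add: E_def)
  have invj: "?w ^ j * z \<in> E \<longleftrightarrow> z \<in> E" for j z
    by (induction j) (simp_all add: inv mult.assoc)
  have intj: "integrable circle_measure (\<lambda>z. indicator E z * q (?w ^ j * z))"
    "(\<integral>z. indicator E z * q (?w ^ j * z) \<partial>circle_measure) = measure circle_measure E" for j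
  proof -
    \<comment> \<open>Invariance of \<open>E\<close> makes the whole integrand a rotate of the one
      for j = 0, to which \<open>mass\<close> applies.\<close>
    have eq: "(\<lambda>z. indicator E z * q (?w ^ j * z)) = (\<lambda>z. indicator E (?w ^ j * z) * q (?w ^ j * z))"
      by (simp add: fun_eq_iff indicator_def invj)
    have w: "norm (?w ^ j) = 1" by (simp add: norm_power)
    have i: "integrable circle_measure (\<lambda>z. indicator E z * q z)"
      using integrable_real_mult_indicator[OF _ intq, of E] by (simp add: mult.commute)
    then have "integrable (distr circle_measure borel ((*) (?w ^ j))) (\<lambda>z. indicator E z * q z)"
      by (simp only: circle_measure_rotate[OF w])
    then show "integrable circle_measure (\<lambda>z. indicator E z * q (?w ^ j * z))"
      unfolding eq by (subst (asm) integrable_distr_eq) simp_all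
    show "(\<integral>z. indicator E z * q (?w ^ j * z) \<partial>circle_measure) = measure circle_measure E"
      unfolding eq
      using integral_rotate[OF w, of "\<lambda>z. indicator E z * q z"] mass[OF E inv] by (simp add: q_def)
  qed
  have intG: "integrable circle_measure (\<lambda>z. indicator E z * G z)"
    unfolding G_def sum_distrib_left by (intro Bochner_Integration.integrable_sum intj)
  have "(\<integral>z. indicator E z * G z \<partial>circle_measure) = n * measure circle_measure E"
    unfolding G_def sum_distrib_left
    by (subst Bochner_Integration.integral_sum[OF intj(1)]) (simp only: intj(2) sum_constant card_lessThan)
  moreover have intE: "integrable circle_measure (\<lambda>z. indicator E z * real n)"
    by (intro integrable_mult_left integrable_real_indicator) (simp_all add: emeasure_finite less_top[symmetric])
  ultimately have "(\<integral>z. indicator E z * G z - indicator E z * real n \<partial>circle_measure) = 0"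
    by (simp add: Bochner_Integration.integral_diff intG)
  moreover have "0 \<le> indicator E z * G z - indicator E z * real n" for z
    by (simp add: indicator_def E_def)
  ultimately have "AE z in circle_measure. indicator E z * G z - indicator E z * real n = 0"
    using intG intE by (subst (asm) integral_nonneg_eq_0_iff_AE) simp_all
  then have "AE z in circle_measure. norm (rep_l2T g z) \<le> sqrt n"
  proof eventually_elim
    fix z assume "indicator E z * G z - indicator E z * real n = 0"
    then have "G z \<le> n" by (auto simp: indicator_def E_def split: if_splits)
    moreover have "q (?w ^ 0 * z) \<le> G z"
      unfolding G_def by (rule member_le_sum[of 0]) (use n in \<open>auto simp: q_def\<close>)
    ultimately show "norm (rep_l2T g z) \<le> sqrt n" by (simp add: q_def real_le_rsqrt)
  qed
  then show ?thesis by (auto simp: ess_bounded_iff)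
qed

section \<open>Symbols of an isometry commuting with a power of the shift\<close>

text \<open>Abstracts the operator \<open>C \<circ> Jstar\<close>. In \<open>shift\<close>, k is any
  integer, negative ones included, because the exponents in a residue class extend in both
  directions.\<close>

locale power_shift_isometry =
  fixes n :: nat and U :: "l2T \<Rightarrow> l2T"
  assumes n_pos: "n > 0"
    and add: "U (f + g) = U f + U g"
    and scale: "U (scaleC a f) = scaleC a (U f)"
    and norm: "norm (U f) = norm f"
    and shift: "U (mult_op (zpow (int n * k)) f) = mult_op (zpow (int n * k)) (U f)"
begin

text \<open>The value forced by the requirement that \<open>U\<close> send
  \<open>zpow (int i - 1)\<close> to its product with the symbol.\<close>

definition symbol :: "nat \<Rightarrow> l2T" where
  "symbol i = mult_op (zpow (1 - int i)) (U (zpow (int i - 1)))"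

lemma mult_zpow_symbol: "mult_op (zpow (int i - 1)) (symbol i) = U (zpow (int i - 1))"
  by (simp add: symbol_def mult_zpow_mult_zpow)

lemma bounded_linear_U: "bounded_linear U"
  by (rule bounded_linear_intro[where K = 1]) (simp_all add: add scaleR_eq_scaleC scale norm)

text \<open>On a monomial of the class, \<open>shift\<close> reduces the claim to the exponent
  \<open>int i - 1\<close>, where it is the definition of \<open>symbol\<close>. The pointwise form
  serves both \<open>mult_op_eqI\<close> and the later computation of masses, which precedes the
  boundedness of the symbol.\<close>

lemma U_eq_symbol_mult:
  assumes "\<And>k. \<not> int n dvd k - (int i - 1) \<Longrightarrow> fourier_coeff f k = 0"
  shows "AE z in circle_measure. rep_l2T (U f) z = rep_l2T (symbol i) z * rep_l2T f z"
proof (rule multiplication_on_has_sum[OF bounded_linear_U arith_progression_has_sum[OF n_pos assms]])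
  fix k :: int
  let ?r = "int i - 1"
  let ?a = "fourier_coeff f (int n * k + ?r)"
  have U: "U (zpow (int n * k + ?r)) = mult_op (zpow (int n * k)) (U (zpow ?r))"
    by (simp add: shift flip: mult_zpow_zpow)
  show "AE z in circle_measure. rep_l2T (U (scaleC ?a (zpow (int n * k + ?r)))) z
      = rep_l2T (symbol i) z * rep_l2T (scaleC ?a (zpow (int n * k + ?r))) z"
    using rep_scaleC_AE[of ?a "zpow (int n * k + ?r)"] rep_zpow_AE[of "int n * k + ?r"]
      rep_scaleC_AE[of ?a "mult_op (zpow (int n * k)) (U (zpow ?r))"]
      rep_mult_zpow_AE[of "int n * k" "U (zpow ?r)"]
      rep_mult_zpow_AE[of "1 - int i" "U (zpow ?r)"] AE_circle_norm
  proof eventually_elim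
    case (elim z)
    then have "z \<noteq> 0" by auto
    then have "z powi (1 - int i) * z powi (int n * k + ?r) = z powi (int n * k)"
      by (simp flip: power_int_add)
    with elim show ?case unfolding scale U symbol_def by (simp add: mult_ac)
  qed
qed

lemma U_eq_block_mult: "U = block_mult_op n symbol"
proof
  fix f
  interpret U: bounded_linear U by (rule bounded_linear_U)
  have "mult_op (symbol i) (component n i f) = U (component n i f)" for i
    by (rule mult_op_eqI, rule U_eq_symbol_mult) (simp add: fourier_coeff_component[OF n_pos])
  then have "block_mult_op n symbol f = U (\<Sum>i=1..n. component n i f)"
    by (simp add: block_mult_op_def U.sum)
  then show "U f = block_mult_op n symbol f" by (simp add: component_sum[OF n_pos, simplified])
qed

lemma ess_bounded_U_zpow: "ess_bounded (U (zpow (int i - 1)))"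
proof (rule bounded_if_rotation_invariant_masses[OF n_pos])
  let ?r = "int i - 1" and ?w = "cis (2 * pi / n)"
  fix E :: "complex set"
  assume E [measurable]: "E \<in> sets borel" and inv: "\<And>z. ?w * z \<in> E \<longleftrightarrow> z \<in> E"
  have [measurable]: "(\<lambda>z::complex. z powi k) \<in> borel_measurable borel" for k
    by (rule power_int_measurable)
  let ?e = "\<lambda>z. indicator E z * z powi ?r"
  have si: "square_integrable ?e"
  proof (rule square_integrable_bounded[where c = 1])
    show "AE z in circle_measure. norm (?e z) \<le> 1"
      using AE_circle_norm by eventually_elim (simp add: norm_mult norm_power_int indicator_def)
  qed simp
  \<comment> \<open>Invariance of \<open>E\<close> under rotation by \<open>?w\<close> gives each
    coefficient of \<open>f\<close> a factor \<open>?w powi (?r - k)\<close> relative to itself, so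
    only exponents congruent to \<open>?r\<close> survive.\<close>
  define f where "f = abs_l2T ?e"
  have "fourier_coeff f k = 0" if k: "\<not> int n dvd k - ?r" for k
  proof -
    have coeff: "fourier_coeff f k = (\<integral>z. indicator E z * z powi (?r - k) \<partial>circle_measure)"
      unfolding fourier_coeff_def cinner_rep
    proof (rule integral_cong_AE)
      show "AE z in circle_measure. rep_l2T f z * cnj (rep_l2T (zpow k) z)
          = indicator E z * z powi (?r - k)"
        using rep_abs_AE[OF si] rep_zpow_AE[of k] AE_circle_norm unfolding f_def
      proof eventually_elim
        case (elim z)
        then have "z \<noteq> 0" by auto
        then have "z powi (?r - k) = z powi ?r * z powi (- k)" by (simp flip: power_int_add)
        with elim show ?case
          by (simp add: cnj_powi_circle mult.assoc del: complex_cnj_power_int)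
      qed
    qed simp_all
    note coeff
    also have "(\<integral>z. indicator E z * z powi (?r - k) \<partial>circle_measure)
        = (\<integral>z. indicator E (?w * z) * (?w * z) powi (?r - k) \<partial>circle_measure)"
      by (rule integral_rotate[symmetric]) simp_all
    also have "\<dots> = ?w powi (?r - k) * (\<integral>z. indicator E z * z powi (?r - k) \<partial>circle_measure)"
    proof -
      have "indicator E (?w * z) = (indicator E z :: complex)" for z
        by (simp add: indicator_def inv)
      then have "(\<lambda>z. indicator E (?w * z) * (?w * z) powi (?r - k))
          = (\<lambda>z. ?w powi (?r - k) * (indicator E z * z powi (?r - k)))"
        by (simp only: power_int_mult_distrib mult.left_commute)
      then show ?thesis by (simp only: integral_mult_right_zero)
    qed
    also have "(\<integral>z. indicator E z * z powi (?r - k) \<partial>circle_measure) = fourier_coeff f k"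
      by (rule coeff[symmetric])
    finally have "fourier_coeff f k = ?w powi (?r - k) * fourier_coeff f k" .
    moreover have "?w powi (?r - k) \<noteq> 1"
    proof
      assume "?w powi (?r - k) = 1"
      then have "?w powi (int j * (?r - k)) = 1" for j
        by (subst mult.commute) (simp only: power_int_mult power_int_1_left)
      \<comment> \<open>All n terms would be 1, and by \<open>roots_of_unity_sum\<close> a nonzero
        sum forces divisibility.\<close>
      then have "(\<Sum>j<n. ?w powi (int j * (?r - k))) \<noteq> 0" using n_pos by simp
      then have "int n dvd ?r - k" using roots_of_unity_sum[OF n_pos] by metis
      with k show False by (simp add: dvd_diff_commute)
    qed
    ultimately show ?thesis by simp
  qed
  then have Uf: "AE z in circle_measure. rep_l2T (U f) z = rep_l2T (symbol i) z * rep_l2T f z"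
    by (rule U_eq_symbol_mult)
  \<comment> \<open>On the circle, \<open>symbol i\<close> and \<open>U (zpow ?r)\<close> have equal
    modulus, and \<open>f\<close> has the modulus of the indicator.\<close>
  have "(\<integral>z. indicator E z * (norm (rep_l2T (U (zpow ?r)) z))\<^sup>2 \<partial>circle_measure) = (norm (U f))\<^sup>2"
    unfolding norm_l2T_power2
  proof (rule integral_cong_AE)
    show "AE z in circle_measure. indicator E z * (norm (rep_l2T (U (zpow ?r)) z))\<^sup>2
        = (norm (rep_l2T (U f) z))\<^sup>2"
      using Uf rep_abs_AE[OF si] rep_mult_zpow_AE[of "1 - int i" "U (zpow ?r)"] AE_circle_norm
      unfolding f_def
      by eventually_elim
        (simp add: symbol_def norm_mult norm_power_int power_mult_distrib indicator_def)
  qed simp_all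
  also have "\<dots> = (norm f)\<^sup>2" by (simp add: norm)
  also have "\<dots> = (\<integral>z. indicator E z \<partial>circle_measure)"
    unfolding norm_l2T_power2
  proof (rule integral_cong_AE)
    show "AE z in circle_measure. (norm (rep_l2T f z))\<^sup>2 = indicator E z"
      using rep_abs_AE[OF si] AE_circle_norm unfolding f_def
      by eventually_elim (simp add: norm_mult norm_power_int indicator_def)
  qed simp_all
  also have "\<dots> = measure circle_measure E" by simp
  finally show "(\<integral>z. indicator E z * (norm (rep_l2T (U (zpow ?r)) z))\<^sup>2 \<partial>circle_measure)
      = measure circle_measure E" .
qed

lemma ess_bounded_symbol: "ess_bounded (symbol i)"
  unfolding symbol_def by (rule ess_bounded_mult_zpow, rule ess_bounded_U_zpow)

end

section \<open>Adjoints and the structure of the conjugation\<close>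

text \<open>The description in \<open>cadjoint\<close> needs uniqueness: the difference of two
  candidate values is orthogonal to every vector, itself included.\<close>

lemma cadjoint_eqI:
  assumes "\<And>f g. cinner (T f) g = cinner f (S g)"
  shows "cadjoint T = S"
  unfolding cadjoint_def
proof (rule the_equality)
  show "\<forall>f g. cinner (T f) g = cinner f (S g)" using assms by blast
  fix R assume R: "\<forall>f g. cinner (T f) g = cinner f (R g)"
  show "R = S"
  proof
    fix g
    have "cinner (R g - S g) (R g - S g) = 0"
      using R assms by (simp add: cinner_diff_right[of _ "R g" "S g"])
    then have "inner (R g - S g) (R g - S g) = 0" by (simp add: inner_l2T_def)
    then show "R g = S g" by simp
  qed
qed

theorem theorem6p2:
  fixes n :: nat and C :: "l2T \<Rightarrow> l2T"
  assumes "n \<ge> 1"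
    and "conjugation C"
    and "C \<circ> mult_op (zpow (int n)) = mult_op (zpow (int n)) \<circ> C"
    and "C ` H2 \<subseteq> H2"
  shows "\<exists>\<xi> :: nat \<Rightarrow> l2T.
           (\<forall>i\<in>{1..n}. \<xi> i \<in> Linfty) \<and>
           (\<forall>i\<in>{1..n}. mult_op (zpow (int i - 1)) (\<xi> i) \<in> Hinfty) \<and>
           C = block_mult_op n \<xi> \<circ> Jstar \<and>
           C_symmetric Jstar (block_mult_op n \<xi>) \<and>
           unitary_op (block_mult_op n \<xi>)"
proof -
  have C: "C (f + g) = C f + C g" "C (scaleC a f) = scaleC (cnj a) (C f)" "C (C f) = f"
    "cinner (C f) (C g) = cinner g f" for f g a
    using assms(2) by (auto simp: conjugation_def)
  \<comment> \<open>A composition of two antilinear involutions: \<open>U\<close> is linear, and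
    \<open>V\<close> is both its inverse and, by \<open>adj\<close>, its adjoint.\<close>
  define U where "U = C \<circ> Jstar"
  define V where "V = Jstar \<circ> C"
  let ?Z = "\<lambda>k. mult_op (zpow k)"
  have C1: "C (?Z (int n) f) = ?Z (int n) (C f)" for f
    using assms(3) by (simp add: fun_eq_iff)
  have Cn: "C (?Z (int n * int k) f) = ?Z (int n * int k) (C f)" for k f
  proof (induction k arbitrary: f)
    case (Suc k)
    have "?Z (int n * int (Suc k)) h = ?Z (int n) (?Z (int n * int k) h)" for h
      by (simp add: mult_zpow_mult_zpow algebra_simps)
    then show ?case by (simp add: C1 Suc)
  qed simp
  have Ck: "C (?Z (int n * k) f) = ?Z (int n * k) (C f)" for k f
  proof (cases "k \<ge> 0")
    case True
    then show ?thesis using Cn[of "nat k" f] by simp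
  next
    case False
    \<comment> \<open>For negative k the commutation is obtained from the positive exponent
      \<open>- k\<close> by cancelling the invertible factor.\<close>
    have "C f = C (?Z (int n * (- k)) (?Z (int n * k) f))" by (simp add: mult_zpow_mult_zpow)
    also have "\<dots> = ?Z (int n * (- k)) (C (?Z (int n * k) f))"
      using Cn[of "nat (- k)" "?Z (int n * k) f"] False by simp
    finally show ?thesis by (simp add: mult_zpow_mult_zpow)
  qed
  \<comment> \<open>The two conjugations, of the variable and of the value, cancel on powers of
    z.\<close>
  have JZ: "Jstar (?Z k f) = ?Z k (Jstar f)" for k f
  proof (rule l2T_eqI)
    have [measurable]: "(\<lambda>z::complex. z powi k) \<in> borel_measurable borel"
      by (rule power_int_measurable)
    have "AE z in circle_measure. rep_l2T (?Z k f) (cnj z) = cnj z powi k * rep_l2T f (cnj z)"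
      by (rule AE_cnj[OF _ rep_mult_zpow_AE]) measurable
    with rep_Jstar_AE[of "?Z k f"] rep_Jstar_AE[of f] rep_mult_zpow_AE[of k "Jstar f"]
    show "AE z in circle_measure. rep_l2T (Jstar (?Z k f)) z = rep_l2T (?Z k (Jstar f)) z"
      by eventually_elim simp
  qed
  interpret power_shift_isometry n U
  proof
    show "n > 0" using assms(1) by simp
    show "U (f + g) = U f + U g" for f g by (simp add: U_def Jstar_add C)
    show "U (scaleC a f) = scaleC a (U f)" for a f by (simp add: U_def Jstar_scaleC C)
    show "norm (U f) = norm f" for f
      by (rule norm_eq_of_cinner) (simp add: U_def C cinner_Jstar)
    show "U (?Z (int n * k) f) = ?Z (int n * k) (U f)" for k f
      by (simp add: U_def JZ Ck)
  qed
  have adj: "cadjoint U = V"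
  proof (rule cadjoint_eqI)
    fix f g
    have "cinner (U f) g = cinner (C (Jstar f)) (C (C g))" by (simp add: U_def C)
    also have "\<dots> = cinner (Jstar (Jstar (C g))) (Jstar f)" by (simp add: C(4))
    also have "\<dots> = cinner f (V g)" by (simp only: cinner_Jstar V_def o_apply)
    finally show "cinner (U f) g = cinner f (V g)" .
  qed
  have bcl: "bounded_clinear U"
    unfolding bounded_clinear_def by (auto simp: add scale norm intro!: exI[of _ 1])
  have "U (zpow (int i - 1)) \<in> Hinfty" if "i \<ge> 1" for i
  proof -
    \<comment> \<open>The exponent is nonnegative as i >= 1. \<open>Jstar\<close> fixes this
      monomial, so the invariance of \<open>H2\<close> under \<open>C\<close> gives the analyticity
      of its image under \<open>U\<close>.\<close>
    have "zpow (int i - 1) \<in> H2" using that by (auto simp: H2_def fourier_coeff_zpow)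
    then have "U (zpow (int i - 1)) \<in> H2" using assms(4) by (auto simp: U_def)
    then show ?thesis using ess_bounded_U_zpow by (simp add: Hinfty_def Linfty_def)
  qed
  then have "(\<forall>i\<in>{1..n}. symbol i \<in> Linfty) \<and>
      (\<forall>i\<in>{1..n}. mult_op (zpow (int i - 1)) (symbol i) \<in> Hinfty)"
    by (simp add: Linfty_def ess_bounded_symbol mult_zpow_symbol)
  moreover have "C = U \<circ> Jstar" by (simp add: U_def fun_eq_iff)
  \<comment> \<open>Cancelling \<open>Jstar \<circ> Jstar\<close> in
    \<open>Jstar \<circ> U \<circ> Jstar\<close> leaves \<open>Jstar \<circ> C\<close>, which is the
    adjoint \<open>V\<close>.\<close>
  moreover have "C_symmetric Jstar U"
    unfolding C_symmetric_def adj using bcl by (simp add: U_def V_def fun_eq_iff)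
  moreover have "unitary_op U"
    unfolding unitary_op_def adj using bcl by (simp add: U_def V_def fun_eq_iff C)
  ultimately show ?thesis
    by (intro exI[of _ symbol]) (simp flip: U_eq_block_mult)
qed

end
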